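(* Suppose that the displacements $(X_i : i\ge 1)$ are i.i.d. real random variables satisfying, for some $\alpha>0$, some slowly varying function $L$ and some $q\in[0,1]$, $$\mathbb P(|X_1|>x)=x^{-\alpha}L(x),\qquad \lim_{x\to\infty}\frac{\mathbb P(X_1>x)}{\mathbb P(|X_1|>x)}=q .$$ Let the progeny variable $Z$ satisfy $\mathbb P(Z\ge 1)=1$, $\mu:=\mathbb E(Z)\in(1,\infty)$ and $\mathbb E(Z\log_+Z)<\infty$. Let $(\gamma_n)_{n\ge1}$ be a positive sequence with $b_n=o(\gamma_n)$, where $b_n=\inf\{x:\mathbb P(|X_1|>x)\le\mu^{-n}\}$, and let $r_n=(\mu^n\mathbb P(|X_1|>\gamma_n))^{-1}$. Then, for every $x>0$, $$\lim_{n\to\infty} r_n\,\mathbb P\big(M_n^{(1)}>\gamma_n x\big)=q\,x^{-\alpha}\,\frac{\mu}{\mu-1}.$$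
   Context: Branching random walk (BRW): it starts with one particle (the root) at position $0$ (generation $0$). After unit time each particle dies and produces, independently of all others, an independent copy of the point process $\mathscr L=\sum_{i=1}^Z\delta_{X_i}$, where $Z$ is a $\{0,1,2,\dots\}$-valued random variable independent of the sequence $(X_i:i\ge1)$. The atoms are the displacements of the children, and the position $S(\mathsf v)$ of a particle $\mathsf v$ is its displacement plus the position of its parent. $|\mathsf v|$ denotes the generation of $\mathsf v$, and $M_n^{(1)}=\max_{|\mathsf v|=n}S(\mathsf v)$. $\log_+x=\log(\max(x,1))$. A function $L$ is slowly varying if $\lim_{t\to\infty}L(tx)/L(t)=1$ for every $x>0$. The condition $b_n=o(\gamma_n)$ means $b_n/\gamma_n\to0$, equivalently $\mu^n\mathbb P(|X_1|>\gamma_n)\to0$. *)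

theory Defs
  imports "HOL-Probability.Probability"
begin

definition slowly_varying :: "(real \<Rightarrow> real) \<Rightarrow> bool" where
  "slowly_varying L \<longleftrightarrow> (\<forall>x>0. ((\<lambda>t. L (t * x) / L t) \<longlongrightarrow> 1) at_top)"

definition log_plus :: "real \<Rightarrow> real" where
  "log_plus x = ln (max x 1)"

text \<open>
  Independence of two random variables; the library's \<open>indep_var\<close> requires both to have values
  in the same type.
\<close>

definition indep_rvs ::
  "'a measure \<Rightarrow> 's measure \<Rightarrow> ('a \<Rightarrow> 's) \<Rightarrow> 't measure \<Rightarrow> ('a \<Rightarrow> 't) \<Rightarrow> bool" where
  "indep_rvs M S X T Y \<longleftrightarrow>
     X \<in> measurable M S \<and> Y \<in> measurable M T \<and>
     prob_space.indep_set M {X -` A \<inter> space M | A. A \<in> sets S}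
                            {Y -` B \<inter> space M | B. B \<in> sets T}"

text \<open>
  The point process \<open>\<L> = \<Sum>i=1..Z. \<delta>(X\<^sub>i)\<close> is encoded by the pair consisting of its number of
  atoms \<open>Z\<close> and the sequence \<open>(X\<^sub>i)\<close>. Children are numbered from \<open>0\<close>, so the atoms are the
  \<open>X i\<close> with \<open>i < Z\<close>, and the first displacement is \<open>X 0\<close>.
\<close>

definition reproduction_space :: "(nat \<times> (nat \<Rightarrow> real)) measure" where
  "reproduction_space = count_space UNIV \<Otimes>\<^sub>M PiM UNIV (\<lambda>_. borel)"

definition reproduction ::
  "('a \<Rightarrow> nat) \<Rightarrow> (nat \<Rightarrow> 'a \<Rightarrow> real) \<Rightarrow> 'a \<Rightarrow> nat \<times> (nat \<Rightarrow> real)" where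
  "reproduction Z X \<omega> = (Z \<omega>, \<lambda>i. X i \<omega>)"

text \<open>
  Particles carry Ulam--Harris labels, written youngest index first: \<open>[]\<close> is the root and
  \<open>i # v\<close> is the \<open>i\<close>-th child of \<open>v\<close>. A branching random walk on the probability space \<open>M\<close> with
  reproduction law that of \<open>(Z, X)\<close> on \<open>Q\<close> is given by the number of children \<open>N v\<close> of each
  label and the displacement \<open>D v i\<close> of the \<open>i\<close>-th child of \<open>v\<close> relative to \<open>v\<close>. As usual, these
  are defined for all labels, including those of particles that are never born.
\<close>

definition branching_random_walk ::
  "'b measure \<Rightarrow> ('b \<Rightarrow> nat) \<Rightarrow> (nat \<Rightarrow> 'b \<Rightarrow> real) \<Rightarrow>
   'a measure \<Rightarrow> (nat list \<Rightarrow> 'a \<Rightarrow> nat) \<Rightarrow> (nat list \<Rightarrow> nat \<Rightarrow> 'a \<Rightarrow> real) \<Rightarrow> bool" where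
  "branching_random_walk Q Z X M N D \<longleftrightarrow>
     prob_space M \<and>
     prob_space.indep_vars M (\<lambda>_. reproduction_space) (\<lambda>v. reproduction (N v) (D v)) UNIV \<and>
     (\<forall>v. distr M reproduction_space (reproduction (N v) (D v)) =
          distr Q reproduction_space (reproduction Z X))"

primrec generation :: "(nat list \<Rightarrow> 'a \<Rightarrow> nat) \<Rightarrow> nat \<Rightarrow> 'a \<Rightarrow> nat list set" where
  "generation N 0 \<omega> = {[]}"
| "generation N (Suc n) \<omega> = {i # v | i v. v \<in> generation N n \<omega> \<and> i < N v \<omega>}"

primrec position :: "(nat list \<Rightarrow> nat \<Rightarrow> 'a \<Rightarrow> real) \<Rightarrow> nat list \<Rightarrow> 'a \<Rightarrow> real" where
  "position D [] \<omega> = 0"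
| "position D (i # v) \<omega> = D v i \<omega> + position D v \<omega>"

text \<open>
  Every generation is finite. It is nonempty only almost surely when \<open>Z \<ge> 1\<close> almost surely;
  on the remaining null event the value below is the unspecified \<open>Max {}\<close>.
\<close>

definition max_position ::
  "(nat list \<Rightarrow> 'a \<Rightarrow> nat) \<Rightarrow> (nat list \<Rightarrow> nat \<Rightarrow> 'a \<Rightarrow> real) \<Rightarrow> nat \<Rightarrow> 'a \<Rightarrow> real" where
  "max_position N D n \<omega> = Max ((\<lambda>v. position D v \<omega>) ` generation N n \<omega>)"

end

theory Submission imports Defs "HOL-Real_Asymp.Real_Asymp" begin

text \<open>
  One big jump. Write \<open>F t = \<P>(\<bar>X\<bar> > t)\<close>, \<open>G t = \<P>(X > t)\<close>, \<open>p\<^sub>n = F (\<gamma>\<^sub>n)\<close> and \<open>y = \<gamma>\<^sub>n x\<close>. Since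
  \<open>b\<^sub>n = o(\<gamma>\<^sub>n)\<close>, the number \<open>\<mu>\<^sup>n p\<^sub>n\<close> tends to \<open>0\<close>: jumps of order \<open>\<gamma>\<^sub>n\<close> are rare even among the
  roughly \<open>\<mu>\<^sup>n\<close> edges of the first \<open>n\<close> generations. Almost surely every particle has descendants in all later
  generations, so the maximum exceeds \<open>y\<close> essentially if and only if one of these edges carries a displacement larger than
  \<open>y\<close>. There are \<open>\<mu> + \<dots> + \<mu>\<^sup>n\<close> such edges on average, which is asymptotically
  \<open>\<mu>\<^sup>n \<mu> / (\<mu> - 1)\<close>, and each exceeds \<open>y\<close> with probability \<open>G y\<close>, where
  \<open>G y / p\<^sub>n\<close> tends to \<open>q x\<^sup>-\<^sup>\<alpha>\<close>. The product of the two, divided by \<open>\<mu>\<^sup>n p\<^sub>n\<close>, gives the limit.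

  Upper bound (\<open>prob_exceeds_le\<close>). If no edge on the way to a particle of generation \<open>n\<close>
  exceeds \<open>(1 - \<epsilon>) y\<close> and at most one exceeds \<open>\<epsilon> y / n\<close>, then its position is at most \<open>y\<close>. So
  either some edge exceeds \<open>(1 - \<epsilon>) y\<close>, which is the main term, or two edges on one ancestral line
  exceed \<open>\<epsilon> y / n\<close>. By the union bound, the latter has probability at most
  \<open>\<mu>\<^sup>n n\<^sup>2 F(\<epsilon> y / n)\<^sup>2\<close>. A regularly varying tail loses only a polynomial factor when its
  argument is divided by \<open>n\<close> (\<open>F_polynomial_bound\<close>), while \<open>p\<^sub>n \<le> \<mu>\<^sup>-\<^sup>n\<close> eventually, hence this is
  \<open>o(\<mu>\<^sup>n p\<^sub>n)\<close> (\<open>two_jumps_negligible\<close>).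

  Lower bound (\<open>prob_exceeds_ge\<close>). The Bonferroni inequality is applied to the events that a
  particle of generation \<open>k \<le> n\<close> is born with a displacement above \<open>(1 + \<epsilon>) y\<close>, and that the other
  edges of one line of length \<open>n\<close> through it are at least \<open>- \<epsilon> y / n\<close>. The correction term
  involves the expected number of pairs of particles, which may be infinite, because \<open>Z\<close> need not
  have a second moment. Therefore the tree is pruned: a particle of generation \<open>j\<close> keeps its
  children only if there are at most \<open>B \<mu>\<^sup>j\<^sup>/\<^sup>2\<close> of them. By the \<open>Z log Z\<close> condition the pruned
  tree still has at least \<open>(1 - \<eta>) \<mu>\<^sup>k\<close> expected particles in generation \<open>k\<close> when \<open>B\<close> is large
  (\<open>prob_truncated_tree_ge\<close>), and its pair counts are of the order \<open>\<mu>\<^sup>k\<^sup>+\<^sup>l\<close>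
  (\<open>pair_sum_truncation_le\<close>). So the correction is of the order \<open>(\<mu>\<^sup>n p\<^sub>n)\<^sup>2\<close>, which is negligible.

  Finally \<open>\<epsilon>\<close> and \<open>\<eta>\<close> tend to \<open>0\<close> (\<open>tendsto_sandwich_family\<close>, \<open>max_position_tail\<close>).
\<close>

section \<open>Independence in a branching random walk\<close>

text \<open>
  The branching random walk with its reproduction law split into the offspring law \<open>\<zeta>\<close> and the
  displacement law \<open>\<xi>\<close>: the numbers of children and the displacements of all labels are independent,
  expressed as a product formula for finitely many constraints.
\<close>

locale branching_data = prob_space M
  for M :: "'a measure" +
  fixes N :: "nat list \<Rightarrow> 'a \<Rightarrow> nat" and D :: "nat list \<Rightarrow> nat \<Rightarrow> 'a \<Rightarrow> real"
    and \<zeta> :: "nat measure" and \<xi> :: "real measure" and \<mu> :: real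
  assumes prob_space_\<zeta>: "prob_space \<zeta>" and sets_\<zeta>: "sets \<zeta> = UNIV"
    and prob_space_\<xi>: "prob_space \<xi>" and sets_\<xi>: "sets \<xi> = sets borel"
    and N_measurable [measurable]: "N v \<in> measurable M (count_space UNIV)"
    and D_measurable [measurable]: "D v i \<in> borel_measurable M"
    and product_formula: "finite J \<Longrightarrow> finite K \<Longrightarrow> (\<And>e. B e \<in> sets borel) \<Longrightarrow>
      prob {\<omega> \<in> space M. (\<forall>v\<in>J. N v \<omega> \<in> A v) \<and> (\<forall>e\<in>K. D (fst e) (snd e) \<omega> \<in> B e)}
        = (\<Prod>v\<in>J. measure \<zeta> (A v)) * (\<Prod>e\<in>K. measure \<xi> (B e))"
    and integrable_\<zeta>: "integrable \<zeta> real" and mean_\<zeta>: "\<mu> = integral\<^sup>L \<zeta> real"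
begin

sublocale \<zeta>: prob_space \<zeta> by (rule prob_space_\<zeta>)
sublocale \<xi>: prob_space \<xi> by (rule prob_space_\<xi>)

lemma space_\<zeta> [simp]: "space \<zeta> = UNIV"
  using sets_\<zeta> by (metis UNIV_I sets.sets_into_space top.extremum_uniqueI)

lemma space_\<xi> [simp]: "space \<xi> = UNIV"
  using sets_eq_imp_space_eq[OF sets_\<xi>] by simp

lemma measurable_\<zeta> [simp]: "f \<in> measurable \<zeta> (count_space UNIV)" "f' \<in> borel_measurable \<zeta>"
  by (auto simp: measurable_def sets_\<zeta>)

lemma mean_nonneg: "\<mu> \<ge> 0" unfolding mean_\<zeta> by simp

text \<open>
  A box over \<open>J\<close> and \<open>K\<close> constrains finitely many of the independent variables, each on its own.
  The events used below are built from boxes, and \<open>box_indep\<close> makes boxes over disjoint index sets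
  independent. The sets \<open>J\<close> and \<open>K\<close> are part of the notion because the event itself does not
  determine which variables it looks at.
\<close>

definition box :: "nat list set \<Rightarrow> (nat list \<times> nat) set \<Rightarrow> 'a set \<Rightarrow> bool" where
  "box J K E \<longleftrightarrow> finite J \<and> finite K \<and> (\<exists>A B. (\<forall>e. B e \<in> sets borel) \<and>
     E = {\<omega> \<in> space M. (\<forall>v\<in>J. N v \<omega> \<in> A v) \<and> (\<forall>e\<in>K. D (fst e) (snd e) \<omega> \<in> B e)})"

lemma box_sets: "box J K E \<Longrightarrow> E \<in> sets M"
proof -
  assume "box J K E"
  then obtain A B where fin: "finite J" "finite K" and B: "\<forall>e. B e \<in> sets borel"
    and E: "E = {\<omega> \<in> space M. (\<forall>v\<in>J. N v \<omega> \<in> A v) \<and> (\<forall>e\<in>K. D (fst e) (snd e) \<omega> \<in> B e)}"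
    unfolding box_def by blast
  have [measurable]: "B e \<in> sets borel" for e using B by blast
  have "{\<omega> \<in> space M. N v \<omega> \<in> A v} \<in> sets M" for v
    using measurable_sets[OF N_measurable, of "A v" v] by (simp add: vimage_def Int_def conj_commute)
  then show ?thesis
    unfolding E using fin by (intro sets.sets_Collect_conj sets.sets_Collect_finite_All) auto
qed

lemma box_space: "box {} {} (space M)"
  by (auto simp: box_def)

lemma box_N: "box {v} {} {\<omega> \<in> space M. N v \<omega> \<in> A}"
  unfolding box_def by (intro conjI exI[of _ "\<lambda>_. A"] exI[of _ "\<lambda>_. UNIV"]) auto

lemma prob_N: "prob {\<omega> \<in> space M. N v \<omega> \<in> A} = measure \<zeta> A"
  using product_formula[of "{v}" "{}" "\<lambda>_. UNIV" "\<lambda>_. A"] by simp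

lemma box_D: "finite K \<Longrightarrow> B \<in> sets borel \<Longrightarrow>
    box {} K {\<omega> \<in> space M. \<forall>e\<in>K. D (fst e) (snd e) \<omega> \<in> B}"
  unfolding box_def by (intro conjI exI[of _ "\<lambda>_. UNIV"] exI[of _ "\<lambda>_. B"]) auto

lemma prob_D: "finite K \<Longrightarrow> B \<in> sets borel \<Longrightarrow>
    prob {\<omega> \<in> space M. \<forall>e\<in>K. D (fst e) (snd e) \<omega> \<in> B} = measure \<xi> B ^ card K"
  using product_formula[of "{}" K "\<lambda>_. B"] by simp

lemma box_Int:
  assumes "box J K E" "box J' K' E'"
  shows "box (J \<union> J') (K \<union> K') (E \<inter> E')"
proof -
  obtain A B where fin: "finite J" "finite K" and B: "\<And>e. B e \<in> sets borel"
    and E: "E = {\<omega> \<in> space M. (\<forall>v\<in>J. N v \<omega> \<in> A v) \<and> (\<forall>e\<in>K. D (fst e) (snd e) \<omega> \<in> B e)}"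
    using assms(1) unfolding box_def by blast
  obtain A' B' where fin': "finite J'" "finite K'" and B': "\<And>e. B' e \<in> sets borel"
    and E': "E' = {\<omega> \<in> space M. (\<forall>v\<in>J'. N v \<omega> \<in> A' v) \<and> (\<forall>e\<in>K'. D (fst e) (snd e) \<omega> \<in> B' e)}"
    using assms(2) unfolding box_def by blast
  show ?thesis
    unfolding box_def
  proof (intro conjI exI allI)
    show "(if e \<in> K then B e else UNIV) \<inter> (if e \<in> K' then B' e else UNIV) \<in> sets borel" for e
      using B[of e] B'[of e] by auto
    show "E \<inter> E' = {\<omega> \<in> space M.
      (\<forall>v\<in>J \<union> J'. N v \<omega> \<in> (if v \<in> J then A v else UNIV) \<inter> (if v \<in> J' then A' v else UNIV)) \<and>
      (\<forall>e\<in>K \<union> K'. D (fst e) (snd e) \<omega> \<in> (if e \<in> K then B e else UNIV) \<inter> (if e \<in> K' then B' e else UNIV))}"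
      unfolding E E' by auto
  qed (use fin fin' in auto)
qed

lemma box_indep:
  assumes "box J K E" "box J' K' E'" "J \<inter> J' = {}" "K \<inter> K' = {}"
  shows "prob (E \<inter> E') = prob E * prob E'"
proof -
  obtain A B where fin: "finite J" "finite K" and B: "\<And>e. B e \<in> sets borel"
    and E: "E = {\<omega> \<in> space M. (\<forall>v\<in>J. N v \<omega> \<in> A v) \<and> (\<forall>e\<in>K. D (fst e) (snd e) \<omega> \<in> B e)}"
    using assms(1) unfolding box_def by blast
  obtain A' B' where fin': "finite J'" "finite K'" and B': "\<And>e. B' e \<in> sets borel"
    and E': "E' = {\<omega> \<in> space M. (\<forall>v\<in>J'. N v \<omega> \<in> A' v) \<and> (\<forall>e\<in>K'. D (fst e) (snd e) \<omega> \<in> B' e)}"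
    using assms(2) unfolding box_def by blast
  let ?A = "\<lambda>v. if v \<in> J then A v else A' v" and ?B = "\<lambda>e. if e \<in> K then B e else B' e"
  have "E \<inter> E' = {\<omega> \<in> space M. (\<forall>v\<in>J \<union> J'. N v \<omega> \<in> ?A v) \<and> (\<forall>e\<in>K \<union> K'. D (fst e) (snd e) \<omega> \<in> ?B e)}"
    unfolding E E' using assms(3,4) by (auto simp: disjoint_iff; metis)
  also have "prob \<dots> = (\<Prod>v\<in>J \<union> J'. measure \<zeta> (?A v)) * (\<Prod>e\<in>K \<union> K'. measure \<xi> (?B e))"
    using fin fin' B B' by (intro product_formula) auto
  also have "(\<Prod>v\<in>J \<union> J'. measure \<zeta> (?A v)) = (\<Prod>v\<in>J. measure \<zeta> (?A v)) * (\<Prod>v\<in>J'. measure \<zeta> (?A v))"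
    using fin fin' assms by (intro prod.union_disjoint) auto
  also have "(\<Prod>v\<in>J. measure \<zeta> (?A v)) = (\<Prod>v\<in>J. measure \<zeta> (A v))"
    by (intro prod.cong) auto
  also have "(\<Prod>v\<in>J'. measure \<zeta> (?A v)) = (\<Prod>v\<in>J'. measure \<zeta> (A' v))"
    using assms by (intro prod.cong) auto
  also have "(\<Prod>e\<in>K \<union> K'. measure \<xi> (?B e)) = (\<Prod>e\<in>K. measure \<xi> (?B e)) * (\<Prod>e\<in>K'. measure \<xi> (?B e))"
    using fin fin' assms by (intro prod.union_disjoint) auto
  also have "(\<Prod>e\<in>K. measure \<xi> (?B e)) = (\<Prod>e\<in>K. measure \<xi> (B e))"
    by (intro prod.cong) auto
  also have "(\<Prod>e\<in>K'. measure \<xi> (?B e)) = (\<Prod>e\<in>K'. measure \<xi> (B' e))"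
    using assms by (intro prod.cong) auto
  finally show ?thesis
    using product_formula[OF fin B, of A] product_formula[OF fin' B', of A'] E E' by simp
qed

lemma prob_Int_N:
  assumes "box J {} E" "v \<notin> J"
  shows "prob (E \<inter> {\<omega> \<in> space M. N v \<omega> \<in> A}) = prob E * measure \<zeta> A"
  using box_indep[OF assms(1) box_N] assms(2) by (simp only: prob_N) auto

section \<open>Moments of pruned trees\<close>

text \<open>
  The event that label \<open>v\<close> is present in the tree pruned below every particle of generation \<open>j\<close>
  whose number of children is not in \<open>T j\<close>; for \<open>T j = UNIV\<close> this is the whole tree.
\<close>

primrec in_tree :: "(nat \<Rightarrow> nat set) \<Rightarrow> nat list \<Rightarrow> 'a set" where
  "in_tree T [] = space M"
| "in_tree T (i # v) = in_tree T v \<inter> {\<omega> \<in> space M. N v \<omega> \<in> {m \<in> T (length v). i < m}}"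

end

primrec ancestors :: "nat list \<Rightarrow> nat list set" where
  "ancestors [] = {}"
| "ancestors (i # v) = insert v (ancestors v)"

primrec path_edges :: "nat list \<Rightarrow> (nat list \<times> nat) set" where
  "path_edges [] = {}"
| "path_edges (i # v) = insert (v, i) (path_edges v)"

lemma length_ancestor: "u \<in> ancestors v \<Longrightarrow> length u < length v"
  by (induction v) auto

lemma length_path_edge: "(u, i) \<in> path_edges v \<Longrightarrow> length u < length v"
  by (induction v) auto

lemma finite_path_edges [simp]: "finite (path_edges v)"
  by (induction v) auto

lemma edge_notin_path_edges [simp]: "(v, i) \<notin> path_edges v"
  using length_path_edge by blast

lemma card_path_edges: "card (path_edges v) = length v"
  by (induction v) auto

lemma position_eq_sum: "position D v \<omega> = (\<Sum>e\<in>path_edges v. D (fst e) (snd e) \<omega>)"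
  by (induction v) auto

text \<open>
  The possible labels of generation \<open>k\<close> when no particle has more than \<open>b\<close> children. The bound makes
  all sums over labels finite. It is sent to infinity for the whole tree, while a large enough bound
  loses nothing in the first generations of a tree pruned at finite thresholds.
\<close>

primrec labels :: "nat \<Rightarrow> nat \<Rightarrow> nat list set" where
  "labels b 0 = {[]}"
| "labels b (Suc k) = (\<lambda>(v, i). i # v) ` (labels b k \<times> {..<b})"

lemma finite_labels [simp]: "finite (labels b k)"
  by (induction k) auto

lemma length_labels: "v \<in> labels b k \<Longrightarrow> length v = k"
  by (induction k arbitrary: v) auto

lemma labels_eq: "labels b k = {v. length v = k \<and> set v \<subseteq> {..<b}}"
  by (induction k) (auto simp: image_iff length_Suc_conv)

lemma sum_labels_Suc: "(\<Sum>v\<in>labels b (Suc k). f v) = (\<Sum>v\<in>labels b k. \<Sum>i<b. f (i # v))"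
  by (simp add: sum.reindex inj_on_def sum.cartesian_product split_def o_def)

context branching_data
begin

lemma box_in_tree: "box (ancestors v) {} (in_tree T v)"
proof (induction v)
  case (Cons i v)
  show ?case using box_Int[OF Cons box_N[of v "{m \<in> T (length v). i < m}"]] by simp
qed (simp add: box_space)

lemma in_tree_sets [measurable]: "in_tree T v \<in> sets M"
  using box_sets[OF box_in_tree] .

text \<open>
  The event that \<open>v\<close> is present only looks at the numbers of children of shorter labels, so it is
  independent of the number of children of \<open>v\<close>.
\<close>

lemma prob_in_tree_Cons:
  "prob (in_tree T (i # v)) = prob (in_tree T v) * measure \<zeta> {m \<in> T (length v). i < m}"
proof -
  have "v \<notin> ancestors v" using length_ancestor by blast
  then show ?thesis
    unfolding in_tree.simps by (rule prob_Int_N[OF box_in_tree])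
qed

text \<open>
  This is the expectation of \<open>min Z b\<close> on the event \<open>Z \<in> T\<close> (see \<open>truncated_mean_eq\<close>), written as a
  sum over the possible children, the form in which it arises from sums over labels.
\<close>

definition truncated_mean :: "nat \<Rightarrow> nat set \<Rightarrow> real" where
  "truncated_mean b T = (\<Sum>i<b. measure \<zeta> {m \<in> T. i < m})"

lemma sum_prob_in_tree:
  "(\<Sum>v\<in>labels b k. prob (in_tree T v)) = (\<Prod>j<k. truncated_mean b (T j))"
proof (induction k)
  case (Suc k)
  have "(\<Sum>v\<in>labels b (Suc k). prob (in_tree T v))
      = (\<Sum>v\<in>labels b k. \<Sum>i<b. prob (in_tree T v) * measure \<zeta> {m \<in> T (length v). i < m})"
    by (simp only: sum_labels_Suc prob_in_tree_Cons)
  also have "\<dots> = (\<Sum>v\<in>labels b k. prob (in_tree T v) * truncated_mean b (T k))"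
    by (intro sum.cong) (auto simp: truncated_mean_def sum_distrib_left length_labels)
  finally show ?case using Suc by (simp add: sum_distrib_right[symmetric])
qed (simp add: prob_space)

lemma truncated_mean_eq: "truncated_mean b T = (\<integral>m. indicator T m * real (min m b) \<partial>\<zeta>)"
proof -
  have "truncated_mean b T = (\<Sum>i<b. \<integral>m. indicator {m \<in> T. i < m} m \<partial>\<zeta>)"
    unfolding truncated_mean_def by simp
  also have "\<dots> = (\<integral>m. (\<Sum>i<b. indicator {m \<in> T. i < m} m) \<partial>\<zeta>)"
    by (intro Bochner_Integration.integral_sum[symmetric])
       (auto intro!: \<zeta>.integrable_const_bound[where B = 1] split: split_indicator)
  also have "(\<lambda>m. (\<Sum>i<b. indicator {m \<in> T. i < m} m :: real)) = (\<lambda>m. indicator T m * real (min m b))"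
  proof
    fix m
    have "(\<Sum>i<b. indicator {m \<in> T. i < m} m :: real) = (\<Sum>i<b. if i \<in> {..<m} then indicator T m else 0)"
      by (intro sum.cong) (auto split: split_indicator)
    also have "\<dots> = (\<Sum>i\<in>{..<b} \<inter> {..<m}. indicator T m)"
      by (subst sum.inter_restrict) auto
    also have "{..<b} \<inter> {..<m} = {..<min m b}" by auto
    finally show "(\<Sum>i<b. indicator {m \<in> T. i < m} m :: real) = indicator T m * real (min m b)"
      by simp
  qed
  finally show ?thesis .
qed

lemma truncated_mean_le: "truncated_mean b T \<le> \<mu>"
  unfolding truncated_mean_eq mean_\<zeta>
  by (intro integral_mono' integrable_\<zeta>) (auto split: split_indicator)

lemma truncated_mean_nonneg: "truncated_mean b T \<ge> 0"
  unfolding truncated_mean_def by (intro sum_nonneg) auto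

lemma sum_prob_in_tree_le: "(\<Sum>v\<in>labels b k. prob (in_tree T v)) \<le> \<mu> ^ k"
proof -
  have "(\<Prod>j<k. truncated_mean b (T j)) \<le> (\<Prod>j<k. \<mu>)"
    by (intro prod_mono) (auto simp: truncated_mean_le truncated_mean_nonneg)
  then show ?thesis by (simp add: sum_prob_in_tree)
qed

text \<open>
  The expectation of the product of the sizes of generations \<open>k\<close> and \<open>l\<close> of the pruned tree, where
  only the first \<open>b\<close> children of each particle are counted.
\<close>

definition pair_sum :: "nat \<Rightarrow> (nat \<Rightarrow> nat set) \<Rightarrow> nat \<Rightarrow> nat \<Rightarrow> real" where
  "pair_sum b T k l = (\<Sum>v\<in>labels b k. \<Sum>w\<in>labels b l. prob (in_tree T v \<inter> in_tree T w))"

lemma pair_sum_commute: "pair_sum b T k l = pair_sum b T l k"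
  unfolding pair_sum_def by (subst sum.swap) (simp add: Int_commute)

lemma pair_sum_nonneg: "pair_sum b T k l \<ge> 0"
  unfolding pair_sum_def by (intro sum_nonneg) auto

text \<open>
  As \<open>k \<le> l\<close>, no label of generation \<open>l\<close> is an ancestor of one of generation \<open>k\<close>, so the offspring of
  generation \<open>l\<close> is independent of both generations.
\<close>

lemma pair_sum_Suc:
  assumes "k \<le> l"
  shows "pair_sum b T k (Suc l) \<le> \<mu> * pair_sum b T k l"
proof -
  have "pair_sum b T k (Suc l) = (\<Sum>v\<in>labels b k. \<Sum>w\<in>labels b l. \<Sum>i<b.
      prob (in_tree T v \<inter> in_tree T w) * measure \<zeta> {m \<in> T l. i < m})"
    unfolding pair_sum_def sum_labels_Suc
  proof (intro sum.cong refl)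
    fix v w i assume v: "v \<in> labels b k" and w: "w \<in> labels b l"
    have "w \<notin> ancestors v \<union> ancestors w"
      using length_ancestor[of w] length_labels[OF v] length_labels[OF w] assms by fastforce
    then have "prob ((in_tree T v \<inter> in_tree T w) \<inter> {\<omega> \<in> space M. N w \<omega> \<in> {m \<in> T (length w). i < m}})
      = prob (in_tree T v \<inter> in_tree T w) * measure \<zeta> {m \<in> T (length w). i < m}"
      using box_Int[OF box_in_tree[of v T] box_in_tree[of w T]] by (intro prob_Int_N) auto
    then show "prob (in_tree T v \<inter> in_tree T (i # w))
      = prob (in_tree T v \<inter> in_tree T w) * measure \<zeta> {m \<in> T l. i < m}"
      using length_labels[OF w] by (simp add: Int_assoc)
  qed
  also have "\<dots> = pair_sum b T k l * truncated_mean b (T l)"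
    by (simp add: pair_sum_def truncated_mean_def sum_distrib_left[symmetric] sum_distrib_right)
  also have "\<dots> \<le> pair_sum b T k l * \<mu>"
    by (intro mult_left_mono truncated_mean_le pair_sum_nonneg)
  finally show ?thesis by (simp add: mult.commute)
qed

text \<open>
  The left side is the expectation of \<open>(min Z b)\<^sup>2\<close> on \<open>Z \<in> T\<close>, and \<open>Z\<^sup>2 \<le> c Z\<close> on \<open>Z \<le> c\<close>.
\<close>

lemma truncated_second_moment_le:
  assumes "T \<subseteq> {m. real m \<le> c}" "c \<ge> 0"
  shows "(\<Sum>i<b. \<Sum>j<b. measure \<zeta> {m \<in> T. i < m \<and> j < m}) \<le> c * \<mu>"
proof -
  have int: "integrable \<zeta> (indicator {m \<in> T. i < m \<and> j < m} :: nat \<Rightarrow> real)" for i j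
    by (auto intro!: \<zeta>.integrable_const_bound[where B = 1] split: split_indicator)
  have "(\<Sum>i<b. \<Sum>j<b. measure \<zeta> {m \<in> T. i < m \<and> j < m})
      = (\<Sum>i<b. \<Sum>j<b. \<integral>m. indicator {m \<in> T. i < m \<and> j < m} m \<partial>\<zeta>)"
    by simp
  also have "\<dots> = (\<Sum>i<b. \<integral>m. (\<Sum>j<b. indicator {m \<in> T. i < m \<and> j < m} m) \<partial>\<zeta>)"
    using int by (intro sum.cong Bochner_Integration.integral_sum[symmetric]) auto
  also have "\<dots> = (\<integral>m. (\<Sum>i<b. \<Sum>j<b. indicator {m \<in> T. i < m \<and> j < m} m) \<partial>\<zeta>)"
    using int by (intro Bochner_Integration.integral_sum[symmetric] Bochner_Integration.integrable_sum) auto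
  also have "\<dots> \<le> (\<integral>m. c * real m \<partial>\<zeta>)"
  proof (intro integral_mono')
    fix m
    have "(\<Sum>i<b. \<Sum>j<b. indicator {m \<in> T. i < m \<and> j < m} m :: real)
        = (\<Sum>i<b. \<Sum>j<b. (if i < m then 1 else 0) * (if j < m then 1 else 0) * indicator T m)"
      by (intro sum.cong) (auto split: split_indicator)
    also have "\<dots> = (\<Sum>i<b. if i < m then 1 else 0) * (\<Sum>i<b. if i < m then 1 else 0) * indicator T m"
      by (subst sum_product) (simp only: sum_distrib_right)
    also have "(\<Sum>i<b. if i < m then 1 else 0 :: real) = real (min m b)"
    proof -
      have "(\<Sum>i<b. if i < m then 1 else 0 :: real) = (\<Sum>i\<in>{..<b} \<inter> {..<m}. 1)"
        by (subst sum.inter_restrict) auto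
      also have "{..<b} \<inter> {..<m} = {..<min m b}" by auto
      finally show ?thesis by simp
    qed
    also have "real (min m b) * real (min m b) * indicator T m \<le> c * real m"
    proof (cases "m \<in> T")
      case True
      then have "real m \<le> c" using assms by auto
      then have "real (min m b) * real (min m b) \<le> c * real m" by (intro mult_mono) auto
      then show ?thesis using True by simp
    next
      case False
      then show ?thesis using assms(2) by simp
    qed
    finally show "(\<Sum>i<b. \<Sum>j<b. indicator {m \<in> T. i < m \<and> j < m} m) \<le> c * real m" .
  qed (use integrable_\<zeta> assms(2) in auto)
  finally show ?thesis by (simp add: mean_\<zeta>)
qed

text \<open>
  Two children with different parents contribute the square of the mean, as the offspring numbers
  of different particles are independent. Siblings contribute the second moment, which is the reason
  for truncating the offspring numbers.
\<close>

lemma pair_sum_Suc_Suc: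
  assumes T: "T k \<subseteq> {m. real m \<le> c}" and c: "c \<ge> 0"
  shows "pair_sum b T (Suc k) (Suc k) \<le> \<mu>\<^sup>2 * pair_sum b T k k + c * \<mu> * \<mu> ^ k"
proof -
  let ?m = "truncated_mean b (T k)"
  have siblings: "(\<Sum>i<b. \<Sum>j<b. prob (in_tree T (i # v) \<inter> in_tree T (j # w)))
      \<le> \<mu>\<^sup>2 * prob (in_tree T v \<inter> in_tree T w) + (if v = w then c * \<mu> * prob (in_tree T v) else 0)"
    if v: "v \<in> labels b k" and w: "w \<in> labels b k" for v w
  proof -
    have len: "length v = k" "length w = k" using v w by (auto simp: length_labels)
    then have notin: "v \<notin> ancestors v" "v \<notin> ancestors w" "w \<notin> ancestors v" "w \<notin> ancestors w"
      using length_ancestor by fastforce+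
    have bx: "box (ancestors v \<union> ancestors w) {} (in_tree T v \<inter> in_tree T w)"
      using box_Int[OF box_in_tree[of v T] box_in_tree[of w T]] by simp
    show ?thesis
    proof (cases "v = w")
      case False
      have "prob (in_tree T (i # v) \<inter> in_tree T (j # w)) =
          prob (in_tree T v \<inter> in_tree T w) * measure \<zeta> {m \<in> T k. i < m} * measure \<zeta> {m \<in> T k. j < m}" for i j
      proof -
        have bx': "box (insert v (ancestors v \<union> ancestors w)) {}
            (in_tree T v \<inter> in_tree T w \<inter> {\<omega> \<in> space M. N v \<omega> \<in> {m \<in> T k. i < m}})"
          using box_Int[OF bx box_N[of v "{m \<in> T k. i < m}"]] by simp
        have "prob (in_tree T v \<inter> in_tree T w \<inter> {\<omega> \<in> space M. N v \<omega> \<in> {m \<in> T k. i < m}})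
            = prob (in_tree T v \<inter> in_tree T w) * measure \<zeta> {m \<in> T k. i < m}"
          by (rule prob_Int_N[OF bx]) (simp add: notin)
        moreover have "prob (in_tree T v \<inter> in_tree T w \<inter> {\<omega> \<in> space M. N v \<omega> \<in> {m \<in> T k. i < m}}
              \<inter> {\<omega> \<in> space M. N w \<omega> \<in> {m \<in> T k. j < m}})
            = prob (in_tree T v \<inter> in_tree T w \<inter> {\<omega> \<in> space M. N v \<omega> \<in> {m \<in> T k. i < m}})
              * measure \<zeta> {m \<in> T k. j < m}"
          by (rule prob_Int_N[OF bx']) (use False notin in simp)
        moreover have "in_tree T (i # v) \<inter> in_tree T (j # w) = in_tree T v \<inter> in_tree T w
            \<inter> {\<omega> \<in> space M. N v \<omega> \<in> {m \<in> T k. i < m}} \<inter> {\<omega> \<in> space M. N w \<omega> \<in> {m \<in> T k. j < m}}"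
          using len by (simp only: in_tree.simps Int_ac)
        ultimately show ?thesis by (simp only:)
      qed
      then have "(\<Sum>i<b. \<Sum>j<b. prob (in_tree T (i # v) \<inter> in_tree T (j # w)))
          = prob (in_tree T v \<inter> in_tree T w) * (?m * ?m)"
        by (simp only: truncated_mean_def sum_product)
           (simp add: sum_distrib_left mult.assoc)
      also have "\<dots> \<le> prob (in_tree T v \<inter> in_tree T w) * (\<mu> * \<mu>)"
        by (intro mult_left_mono mult_mono truncated_mean_le truncated_mean_nonneg mean_nonneg) auto
      finally show ?thesis using False by (simp add: power2_eq_square mult_ac)
    next
      case True
      have "prob (in_tree T (i # v) \<inter> in_tree T (j # w)) =
          prob (in_tree T v) * measure \<zeta> {m \<in> T k. i < m \<and> j < m}" for i j
      proof -
        have "in_tree T (i # v) \<inter> in_tree T (j # w)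
            = in_tree T v \<inter> {\<omega> \<in> space M. N v \<omega> \<in> {m \<in> T k. i < m \<and> j < m}}"
          using len True by auto
        also have "prob \<dots> = prob (in_tree T v) * measure \<zeta> {m \<in> T k. i < m \<and> j < m}"
          using notin by (intro prob_Int_N[OF box_in_tree]) auto
        finally show ?thesis .
      qed
      then have "(\<Sum>i<b. \<Sum>j<b. prob (in_tree T (i # v) \<inter> in_tree T (j # w)))
          = prob (in_tree T v) * (\<Sum>i<b. \<Sum>j<b. measure \<zeta> {m \<in> T k. i < m \<and> j < m})"
        by (simp add: sum_distrib_left)
      also have "\<dots> \<le> prob (in_tree T v) * (c * \<mu>)"
        by (intro mult_left_mono truncated_second_moment_le T c) auto
      also have "\<dots> \<le> c * \<mu> * prob (in_tree T v) + \<mu>\<^sup>2 * prob (in_tree T v \<inter> in_tree T w)"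
        by simp
      finally show ?thesis using True by simp
    qed
  qed
  have "pair_sum b T (Suc k) (Suc k)
      = (\<Sum>v\<in>labels b k. \<Sum>w\<in>labels b k. \<Sum>i<b. \<Sum>j<b. prob (in_tree T (i # v) \<inter> in_tree T (j # w)))"
    unfolding pair_sum_def sum_labels_Suc by (subst sum.swap) (rule refl)
  also have "\<dots> \<le> (\<Sum>v\<in>labels b k. \<Sum>w\<in>labels b k. \<mu>\<^sup>2 * prob (in_tree T v \<inter> in_tree T w)
      + (if v = w then c * \<mu> * prob (in_tree T v) else 0))"
    by (intro sum_mono siblings)
  also have "\<dots> = \<mu>\<^sup>2 * pair_sum b T k k + c * \<mu> * (\<Sum>v\<in>labels b k. prob (in_tree T v))"
    by (simp add: sum.distrib pair_sum_def sum_distrib_left)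
  also have "\<dots> \<le> \<mu>\<^sup>2 * pair_sum b T k k + c * \<mu> * \<mu> ^ k"
    by (intro add_left_mono mult_left_mono sum_prob_in_tree_le mult_nonneg_nonneg c mean_nonneg)
  finally show ?thesis .
qed

end

section \<open>Particles above a level and the maximal position\<close>

context branching_data
begin

abbreviation whole_tree :: "nat list \<Rightarrow> 'a set" where
  "whole_tree \<equiv> in_tree (\<lambda>_. UNIV)"

lemma in_tree_subset_space: "in_tree T v \<subseteq> space M"
  by (induction v) auto

lemma in_tree_subset_whole_tree: "in_tree T v \<subseteq> whole_tree v"
  by (induction v) auto

lemma generation_eq:
  assumes "\<omega> \<in> space M"
  shows "generation N n \<omega> = {v. length v = n \<and> \<omega> \<in> whole_tree v}"
proof (induction n)
  case (Suc n)
  show ?case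
  proof (rule set_eqI)
    fix v
    show "v \<in> generation N (Suc n) \<omega> \<longleftrightarrow> v \<in> {v. length v = Suc n \<and> \<omega> \<in> whole_tree v}"
      using assms Suc by (cases v) auto
  qed
qed (use assms in auto)

lemma finite_generation: "finite (generation N n \<omega>)"
proof (induction n)
  case (Suc n)
  have "generation N (Suc n) \<omega> = (\<Union>v\<in>generation N n \<omega>. (\<lambda>i. i # v) ` {..<N v \<omega>})" by auto
  then show ?case using Suc by simp
qed simp

lemma measurable_position [measurable]: "position D v \<in> borel_measurable M"
  unfolding position_eq_sum[abs_def] by measurable

text \<open>
  The event that some particle of generation \<open>n\<close> lies above \<open>y\<close>. It differs from the event
  that the maximal position exceeds \<open>y\<close> only where generation \<open>n\<close> is empty (see \<open>prob_max_position\<close>).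
\<close>

definition exceeds :: "nat \<Rightarrow> real \<Rightarrow> 'a set" where
  "exceeds n y = (\<Union>v\<in>{v. length v = n}. whole_tree v \<inter> {\<omega> \<in> space M. position D v \<omega> > y})"

lemma exceeds_sets [measurable]: "exceeds n y \<in> sets M"
  unfolding exceeds_def
  by (intro sets.countable_UN' sets.Int in_tree_sets) (auto intro: countable_subset[OF subset_UNIV])

text \<open>
  A union bound over a whole generation, obtained from finite sets of labels by continuity from
  below.
\<close>

lemma prob_generation_Union_le:
  assumes E: "\<And>v. E v \<in> sets M" and le: "\<And>b. (\<Sum>v\<in>labels b k. prob (E v)) \<le> C"
  shows "prob (\<Union>v\<in>{v. length v = k}. E v) \<le> C"
proof -
  have "prob (\<Union>v\<in>labels b k. E v) \<le> C" for b
    by (rule order_trans[OF finite_measure_subadditive_finite le]) (use E in auto)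
  moreover have "(\<lambda>b. prob (\<Union>v\<in>labels b k. E v)) \<longlonglongrightarrow> prob (\<Union>b. \<Union>v\<in>labels b k. E v)"
  proof (rule finite_Lim_measure_incseq)
    show "range (\<lambda>b. \<Union>v\<in>labels b k. E v) \<subseteq> sets M"
      using E by (auto intro!: sets.finite_UN)
    have "labels b k \<subseteq> labels b' k" if "b \<le> b'" for b b'
      unfolding labels_eq using that by fastforce
    then show "incseq (\<lambda>b. \<Union>v\<in>labels b k. E v)"
      by (intro monoI UN_mono) auto
  qed
  moreover have "(\<Union>b. \<Union>v\<in>labels b k. E v) = (\<Union>v\<in>{v. length v = k}. E v)"
  proof -
    have "\<exists>b. set v \<subseteq> {..<b}" for v :: "nat list"
      by (metis List.finite_set finite_nat_iff_bounded)
    then show ?thesis by (fastforce simp: labels_eq)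
  qed
  ultimately show ?thesis by (intro LIMSEQ_le_const2) auto
qed

lemma in_tree_path_edge:
  "\<omega> \<in> in_tree T v \<Longrightarrow> (u, i) \<in> path_edges v \<Longrightarrow> \<omega> \<in> in_tree T (i # u)"
  by (induction v) auto

lemma prob_in_tree_D:
  assumes "finite K" "B \<in> sets borel"
  shows "prob (in_tree T v \<inter> {\<omega> \<in> space M. \<forall>e\<in>K. D (fst e) (snd e) \<omega> \<in> B})
    = prob (in_tree T v) * measure \<xi> B ^ card K"
  using box_indep[OF box_in_tree box_D[OF assms]] prob_D[OF assms] by simp

lemma AE_offspring_pos:
  assumes "measure \<zeta> {1..} = 1"
  shows "AE \<omega> in M. \<forall>v. N v \<omega> \<ge> 1"
proof -
  have "prob {\<omega> \<in> space M. N v \<omega> \<in> {1..}} = 1" for v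
    unfolding prob_N by (rule assms)
  then have "AE \<omega> in M. \<omega> \<in> {\<omega> \<in> space M. N v \<omega> \<in> {1..}}" for v
    by (rule AE_prob_1)
  then show ?thesis
    by (subst AE_all_countable) (auto elim!: eventually_mono)
qed

lemma whole_tree_replicate:
  assumes "\<omega> \<in> whole_tree v" "\<forall>u. N u \<omega> \<ge> 1"
  shows "\<omega> \<in> whole_tree (replicate k 0 @ v)"
proof -
  have "0 < N u \<omega>" for u using assms(2) by (metis less_eq_Suc_le One_nat_def)
  moreover have "\<omega> \<in> space M" using assms(1) in_tree_subset_space by blast
  ultimately show ?thesis using assms(1) by (induction k) auto
qed

lemma path_edges_append: "path_edges v \<subseteq> path_edges (w @ v)"
  by (induction w) auto

lemma prob_max_position:
  assumes "measure \<zeta> {1..} = 1"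
  shows "prob {\<omega> \<in> space M. max_position N D n \<omega> > y} = prob (exceeds n y)"
proof -
  \<comment> \<open>The null event that generation \<open>n\<close> is empty, on which the maximum is unspecified.\<close>
  let ?E = "space M - (\<Union>v\<in>{v. length v = n}. whole_tree v)"
  have sets_E: "?E \<in> sets M"
    by (intro sets.Diff sets.top sets.countable_UN' in_tree_sets ballI) auto
  have eq: "max_position N D n \<omega> > y \<longleftrightarrow> \<omega> \<in> exceeds n y"
    if "\<omega> \<in> space M" "\<omega> \<notin> ?E" for \<omega>
  proof -
    have "generation N n \<omega> \<noteq> {}" using that by (auto simp: generation_eq)
    then have "max_position N D n \<omega> > y \<longleftrightarrow> (\<exists>v\<in>generation N n \<omega>. position D v \<omega> > y)"
      unfolding max_position_def by (subst Max_gr_iff) (auto simp: finite_generation)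
    then show ?thesis
      using that(1) by (auto simp: exceeds_def generation_eq)
  qed
  have empty: "max_position N D n \<omega> = Max {}" "\<omega> \<notin> exceeds n y" if "\<omega> \<in> ?E" for \<omega>
  proof -
    have "generation N n \<omega> = {}" using that by (auto simp: generation_eq)
    then show "max_position N D n \<omega> = Max {}" by (simp add: max_position_def)
    show "\<omega> \<notin> exceeds n y" using that by (auto simp: exceeds_def)
  qed
  have "{\<omega> \<in> space M. max_position N D n \<omega> > y}
      = exceeds n y \<union> (if Max {} > y then ?E else {})"
  proof (rule set_eqI)
    fix \<omega>
    have "\<omega> \<in> exceeds n y \<Longrightarrow> \<omega> \<in> space M"
      using sets.sets_into_space[OF exceeds_sets] by blast
    then show "\<omega> \<in> {\<omega> \<in> space M. max_position N D n \<omega> > y}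
        \<longleftrightarrow> \<omega> \<in> exceeds n y \<union> (if Max {} > y then ?E else {})"
      using eq[of \<omega>] empty[of \<omega>] by (cases "\<omega> \<in> ?E") auto
  qed
  then have sets: "{\<omega> \<in> space M. max_position N D n \<omega> > y} \<in> sets M"
    using sets_E exceeds_sets by simp
  have "AE \<omega> in M. \<omega> \<notin> ?E"
    using AE_offspring_pos[OF assms]
  proof eventually_elim
    fix \<omega> assume N: "\<forall>v. N v \<omega> \<ge> 1"
    show "\<omega> \<notin> ?E"
    proof
      assume "\<omega> \<in> ?E"
      then have "\<omega> \<in> whole_tree []" by simp
      from whole_tree_replicate[OF this N, of n] \<open>\<omega> \<in> ?E\<close> show False by auto
    qed
  qed
  then show ?thesis
    using eq AE_space by (intro finite_measure_eq_AE sets exceeds_sets) auto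
qed

end

section \<open>Bounds on the probability of exceeding a level\<close>

lemma (in prob_space) Bonferroni_lower:
  assumes "finite I" "\<And>i. i \<in> I \<Longrightarrow> A i \<in> sets M"
  shows "prob (\<Union>i\<in>I. A i) \<ge> (\<Sum>i\<in>I. prob (A i)) - (\<Sum>i\<in>I. \<Sum>j\<in>I - {i}. prob (A i \<inter> A j))"
  using assms
proof (induction I rule: finite_induct)
  case (insert x I)
  have [measurable]: "A i \<in> sets M" if "i \<in> insert x I" for i using insert that by auto
  have m: "A x \<in> sets M" "(\<Union>i\<in>I. A i) \<in> sets M" "\<And>i. i \<in> I \<Longrightarrow> A x \<inter> A i \<in> sets M"
    using insert by auto
  have "prob (A x \<inter> (\<Union>i\<in>I. A i)) = prob (\<Union>i\<in>I. A x \<inter> A i)" by (simp only: Int_UN_distrib)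
  also have "\<dots> \<le> (\<Sum>i\<in>I. prob (A x \<inter> A i))"
    using insert m by (intro finite_measure_subadditive_finite) auto
  finally have 1: "prob (A x \<inter> (\<Union>i\<in>I. A i)) \<le> (\<Sum>i\<in>I. prob (A x \<inter> A i))" .
  have 2: "prob (\<Union>i\<in>insert x I. A i) = prob (A x) + prob (\<Union>i\<in>I. A i) - prob (A x \<inter> (\<Union>i\<in>I. A i))"
    using measure_Un3[of "A x" M "\<Union>i\<in>I. A i"] m by (simp add: fmeasurable_eq_sets)
  have 3: "(\<Sum>i\<in>I. \<Sum>j\<in>I - {i}. prob (A i \<inter> A j)) \<le> (\<Sum>i\<in>I. \<Sum>j\<in>insert x I - {i}. prob (A i \<inter> A j))"
    using insert(1) by (intro sum_mono sum_mono2) auto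
  have 4: "(\<Sum>i\<in>insert x I. \<Sum>j\<in>insert x I - {i}. prob (A i \<inter> A j))
      = (\<Sum>i\<in>I. prob (A x \<inter> A i)) + (\<Sum>i\<in>I. \<Sum>j\<in>insert x I - {i}. prob (A i \<inter> A j))"
    using insert(1,2) by simp
  have 5: "(\<Sum>i\<in>I. prob (A i)) - (\<Sum>i\<in>I. \<Sum>j\<in>I - {i}. prob (A i \<inter> A j)) \<le> prob (\<Union>i\<in>I. A i)"
    using insert by auto
  have 6: "(\<Sum>i\<in>insert x I. prob (A i)) = prob (A x) + (\<Sum>i\<in>I. prob (A i))"
    using insert by simp
  show ?case using 1 2 3 4 5 6 by linarith
qed simp

context branching_data
begin

text \<open>
  One big edge decides on which side of \<open>y\<close> the particle lies: the other \<open>n - 1\<close> edges shift it by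
  less than \<open>\<epsilon> y\<close> in total, in the direction that matters.
\<close>

lemma position_bounds:
  assumes y: "y > 0" and \<epsilon>: "0 < \<epsilon>" and n: "length v = n"
    and K: "K \<subseteq> path_edges v" "card K = 1"
  shows "(\<forall>e\<in>K. D (fst e) (snd e) \<omega> > (1 + \<epsilon>) * y) \<Longrightarrow>
      (\<forall>e\<in>path_edges v - K. D (fst e) (snd e) \<omega> \<ge> - (\<epsilon> * y / n)) \<Longrightarrow> position D v \<omega> > y"
    and "(\<forall>e\<in>K. D (fst e) (snd e) \<omega> \<le> (1 - \<epsilon>) * y) \<Longrightarrow>
      (\<forall>e\<in>path_edges v - K. D (fst e) (snd e) \<omega> \<le> \<epsilon> * y / n) \<Longrightarrow> position D v \<omega> \<le> y"
proof -
  obtain e where e: "K = {e}" using K(2) by (auto simp: card_1_singleton_iff)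
  have card: "card (path_edges v - K) = n - 1" "n \<ge> 1"
    using K n card_path_edges[of v] e by (auto simp: Suc_le_eq card_gt_0_iff)
  have pos: "position D v \<omega> = D (fst e) (snd e) \<omega> + (\<Sum>e\<in>path_edges v - K. D (fst e) (snd e) \<omega>)"
    unfolding position_eq_sum e using K e by (subst sum.remove[of _ e]) auto
  have small: "(n - 1) * (\<epsilon> * y / n) \<le> \<epsilon> * y"
    using y \<epsilon> card by (simp add: field_simps)
  {
    assume big: "\<forall>e\<in>K. D (fst e) (snd e) \<omega> > (1 + \<epsilon>) * y"
      and "\<forall>e\<in>path_edges v - K. D (fst e) (snd e) \<omega> \<ge> - (\<epsilon> * y / n)"
    then have "of_nat (card (path_edges v - K)) * - (\<epsilon> * y / n)
        \<le> (\<Sum>e\<in>path_edges v - K. D (fst e) (snd e) \<omega>)"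
      by (intro sum_bounded_below) auto
    then show "position D v \<omega> > y"
      using big small card unfolding pos e by (simp add: algebra_simps)
  next
    assume big: "\<forall>e\<in>K. D (fst e) (snd e) \<omega> \<le> (1 - \<epsilon>) * y"
      and "\<forall>e\<in>path_edges v - K. D (fst e) (snd e) \<omega> \<le> \<epsilon> * y / n"
    then have "(\<Sum>e\<in>path_edges v - K. D (fst e) (snd e) \<omega>)
        \<le> of_nat (card (path_edges v - K)) * (\<epsilon> * y / n)"
      by (intro sum_bounded_above) auto
    then show "position D v \<omega> \<le> y"
      using big small card unfolding pos e by (simp add: algebra_simps)
  }
qed

text \<open>
  The first term bounds the probability of one jump above \<open>(1 - \<epsilon>) y\<close> anywhere in the tree, by the
  expected number of such jumps; the second bounds that of two jumps above \<open>\<epsilon> y / n\<close> on one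
  ancestral line. By \<open>position_bounds\<close> there is no other way to exceed \<open>y\<close>.
\<close>

lemma prob_exceeds_le:
  assumes y: "y > 0" and \<epsilon>: "0 < \<epsilon>" and n: "n \<ge> 1"
  shows "prob (exceeds n y) \<le> (\<Sum>k=1..n. \<mu> ^ k) * measure \<xi> {(1 - \<epsilon>) * y <..}
    + real n ^ 2 * \<mu> ^ n * measure \<xi> {\<epsilon> * y / n <..} ^ 2"
proof -
  let ?g = "measure \<xi> {(1 - \<epsilon>) * y <..}" and ?h = "measure \<xi> {\<epsilon> * y / n <..}"
  \<comment> \<open>The edge leading to \<open>v\<close> makes a big jump.\<close>
  define U where "U v = whole_tree v \<inter>
    {\<omega> \<in> space M. \<forall>e\<in>{(tl v, hd v)}. D (fst e) (snd e) \<omega> \<in> {(1 - \<epsilon>) * y <..}}" for v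
  define W where "W v p = whole_tree v \<inter>
    {\<omega> \<in> space M. \<forall>e\<in>{fst p, snd p}. D (fst e) (snd e) \<omega> \<in> {\<epsilon> * y / n <..}}" for v p
  define pairs where "pairs v = {p \<in> path_edges v \<times> path_edges v. fst p \<noteq> snd p}" for v
  have fin [simp]: "finite (pairs v)" for v unfolding pairs_def by auto
  have U_sets: "U v \<in> sets M" for v unfolding U_def by measurable
  have W_sets: "W v p \<in> sets M" for v p unfolding W_def by measurable
  have U: "prob (\<Union>v\<in>{v. length v = k}. U v) \<le> \<mu> ^ k * ?g" for k
  proof (rule prob_generation_Union_le)
    fix b
    have "(\<Sum>v\<in>labels b k. prob (U v)) = (\<Sum>v\<in>labels b k. prob (whole_tree v)) * ?g"
      unfolding U_def by (subst prob_in_tree_D) (auto simp: sum_distrib_right)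
    also have "\<dots> \<le> \<mu> ^ k * ?g" by (intro mult_right_mono sum_prob_in_tree_le) auto
    finally show "(\<Sum>v\<in>labels b k. prob (U v)) \<le> \<mu> ^ k * ?g" .
  qed (rule U_sets)
  have W: "prob (\<Union>v\<in>{v. length v = n}. \<Union>p\<in>pairs v. W v p) \<le> real n ^ 2 * \<mu> ^ n * ?h ^ 2"
  proof (rule prob_generation_Union_le)
    show "(\<Union>p\<in>pairs v. W v p) \<in> sets M" for v
      using W_sets by (intro sets.finite_UN) auto
    fix b
    have "(\<Sum>v\<in>labels b n. prob (\<Union>p\<in>pairs v. W v p))
        \<le> (\<Sum>v\<in>labels b n. prob (whole_tree v) * (real n ^ 2 * ?h ^ 2))"
    proof (intro sum_mono)
      fix v assume v: "v \<in> labels b n"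
      have "prob (\<Union>p\<in>pairs v. W v p) \<le> (\<Sum>p\<in>pairs v. prob (W v p))"
        using W_sets by (intro finite_measure_subadditive_finite) auto
      also have "\<dots> = (\<Sum>p\<in>pairs v. prob (whole_tree v) * ?h ^ 2)"
      proof (intro sum.cong refl)
        fix p assume "p \<in> pairs v"
        then have "card {fst p, snd p} = 2" by (auto simp: pairs_def)
        then show "prob (W v p) = prob (whole_tree v) * ?h ^ 2"
          unfolding W_def by (subst prob_in_tree_D) auto
      qed
      also have "\<dots> = real (card (pairs v)) * (prob (whole_tree v) * ?h ^ 2)" by simp
      also have "\<dots> \<le> real (n ^ 2) * (prob (whole_tree v) * ?h ^ 2)"
      proof (intro mult_right_mono of_nat_mono)
        have "card (pairs v) \<le> card (path_edges v \<times> path_edges v)"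
          by (intro card_mono) (auto simp: pairs_def)
        then show "card (pairs v) \<le> n ^ 2"
          using length_labels[OF v] by (simp add: card_path_edges power2_eq_square)
      qed auto
      finally show "prob (\<Union>p\<in>pairs v. W v p) \<le> prob (whole_tree v) * (real n ^ 2 * ?h ^ 2)"
        by (simp add: mult_ac)
    qed
    also have "\<dots> = (\<Sum>v\<in>labels b n. prob (whole_tree v)) * (real n ^ 2 * ?h ^ 2)"
      by (simp add: sum_distrib_right)
    also have "\<dots> \<le> \<mu> ^ n * (real n ^ 2 * ?h ^ 2)"
      by (intro mult_right_mono sum_prob_in_tree_le) auto
    finally show "(\<Sum>v\<in>labels b n. prob (\<Union>p\<in>pairs v. W v p)) \<le> real n ^ 2 * \<mu> ^ n * ?h ^ 2"
      by (simp add: mult_ac)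
  qed
  have sets1: "(\<Union>v\<in>{v. length v = k}. U v) \<in> sets M" for k
    using U_sets by (intro sets.countable_UN') (auto intro: countable_subset[OF subset_UNIV])
  then have sets1': "(\<Union>k\<in>{1..n}. \<Union>v\<in>{v. length v = k}. U v) \<in> sets M"
    by (intro sets.finite_UN[OF finite_atLeastAtMost])
  have sets2: "(\<Union>v\<in>{v. length v = n}. \<Union>p\<in>pairs v. W v p) \<in> sets M"
    using W_sets by (intro sets.countable_UN' ballI sets.finite_UN[OF fin]) auto
  have "exceeds n y \<subseteq> (\<Union>k\<in>{1..n}. \<Union>v\<in>{v. length v = k}. U v)
      \<union> (\<Union>v\<in>{v. length v = n}. \<Union>p\<in>pairs v. W v p)"
  proof (rule subsetI, rule ccontr)
    fix \<omega> assume "\<omega> \<in> exceeds n y"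
      and not: "\<omega> \<notin> (\<Union>k\<in>{1..n}. \<Union>v\<in>{v. length v = k}. U v)
        \<union> (\<Union>v\<in>{v. length v = n}. \<Union>p\<in>pairs v. W v p)"
    then obtain v where v: "length v = n" "\<omega> \<in> whole_tree v" "\<omega> \<in> space M" "position D v \<omega> > y"
      unfolding exceeds_def by auto
    have le: "D (fst e) (snd e) \<omega> \<le> (1 - \<epsilon>) * y" if "e \<in> path_edges v" for e
    proof (rule ccontr)
      assume "\<not> D (fst e) (snd e) \<omega> \<le> (1 - \<epsilon>) * y"
      then have "\<omega> \<in> U (snd e # fst e)"
        using that in_tree_path_edge[OF v(2), of "fst e" "snd e"] v(3) by (simp add: U_def)
      moreover have "length (snd e # fst e) \<in> {1..n}"
        using length_path_edge[of "fst e" "snd e" v] that v(1) by simp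
      ultimately show False using not by blast
    qed
    have unique: "e = e'" if "e \<in> path_edges v" "e' \<in> path_edges v"
      "D (fst e) (snd e) \<omega> > \<epsilon> * y / n" "D (fst e') (snd e') \<omega> > \<epsilon> * y / n" for e e'
    proof (rule ccontr)
      assume "e \<noteq> e'"
      then have "(e, e') \<in> pairs v" "\<omega> \<in> W v (e, e')"
        using that v by (auto simp: pairs_def W_def)
      then show False using not v(1) by blast
    qed
    have "path_edges v \<noteq> {}" using v(1) n by (cases v) auto
    then obtain e where e: "e \<in> path_edges v"
      "\<And>e'. e' \<in> path_edges v \<Longrightarrow> e' \<noteq> e \<Longrightarrow> D (fst e') (snd e') \<omega> \<le> \<epsilon> * y / n"
      using unique by (meson all_not_in_conv not_less)
    have "position D v \<omega> \<le> y"
      using y \<epsilon> v(1) e le by (intro position_bounds(2)[where K = "{e}" and \<epsilon> = \<epsilon>]) auto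
    with v(4) show False by simp
  qed
  then have "prob (exceeds n y) \<le> prob ((\<Union>k\<in>{1..n}. \<Union>v\<in>{v. length v = k}. U v)
      \<union> (\<Union>v\<in>{v. length v = n}. \<Union>p\<in>pairs v. W v p))"
    by (intro finite_measure_mono sets.Un sets1' sets2)
  also have "\<dots> \<le> prob (\<Union>k\<in>{1..n}. \<Union>v\<in>{v. length v = k}. U v)
      + prob (\<Union>v\<in>{v. length v = n}. \<Union>p\<in>pairs v. W v p)"
    by (intro measure_Un_le sets1' sets2)
  also have "prob (\<Union>k\<in>{1..n}. \<Union>v\<in>{v. length v = k}. U v)
      \<le> (\<Sum>k=1..n. prob (\<Union>v\<in>{v. length v = k}. U v))"
    using sets1 by (intro finite_measure_subadditive_finite) auto
  also have "\<dots> \<le> (\<Sum>k=1..n. \<mu> ^ k) * ?g"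
    unfolding sum_distrib_right by (intro sum_mono U)
  finally show ?thesis using W by linarith
qed

text \<open>
  The first term bounds the sum of the probabilities in the Bonferroni inequality from below, the
  second bounds the sum over pairs from above. In the pair events only the two big jumps and the
  presence of the two particles are kept. The jumps are independent of each other, also when one
  particle is an ancestor of the other, as the two edges are distinct. The pruning \<open>T\<close> is arbitrary here; it only has to leave enough particles and few
  enough pairs.
\<close>

lemma prob_exceeds_ge:
  assumes y: "y > 0" and \<epsilon>: "0 < \<epsilon>" and n: "n \<ge> 1" and pos: "measure \<zeta> {1..} = 1"
    and first: "\<And>k. k \<le> n \<Longrightarrow> c * \<mu> ^ k \<le> (\<Sum>v\<in>labels b k. prob (in_tree T v))"
    and second: "\<And>k l. k \<le> n \<Longrightarrow> l \<le> n \<Longrightarrow> pair_sum b T k l \<le> C * \<mu> ^ (k + l)"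
  shows "prob (exceeds n y) \<ge>
    c * (\<Sum>k=1..n. \<mu> ^ k) * measure \<xi> {(1 + \<epsilon>) * y <..} * measure \<xi> {- (\<epsilon> * y / n)..} ^ (n - 1)
    - C * (\<Sum>k=1..n. \<mu> ^ k)\<^sup>2 * (measure \<xi> {(1 + \<epsilon>) * y <..})\<^sup>2"
proof -
  let ?g = "measure \<xi> {(1 + \<epsilon>) * y <..}" and ?h = "measure \<xi> {- (\<epsilon> * y / n)..}"
  define edge where "edge v = (tl v, hd v)" for v :: "nat list"
  \<comment> \<open>The first child of each particle continues the line of \<open>v\<close> down to generation \<open>n\<close>.\<close>
  define path where "path v = replicate (n - length v) 0 @ v" for v :: "nat list"
  define A' where "A' v = in_tree T v \<inter>
    {\<omega> \<in> space M. \<forall>e\<in>{edge v}. D (fst e) (snd e) \<omega> \<in> {(1 + \<epsilon>) * y <..}}" for v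
  define A where "A v = A' v \<inter>
    {\<omega> \<in> space M. \<forall>e\<in>path_edges (path v) - {edge v}. D (fst e) (snd e) \<omega> \<in> {- (\<epsilon> * y / n)..}}" for v
  define I where "I = (\<Union>k\<in>{1..n}. labels b k)"
  have fin: "finite I" unfolding I_def by auto
  have len: "1 \<le> length v" "length v \<le> n" if "v \<in> I" for v
    using that by (auto simp: I_def length_labels)
  have edge: "edge v \<in> path_edges (path v)" "length (path v) = n" if v: "v \<in> I" for v
  proof -
    obtain i u where "v = i # u" using len(1)[OF v] by (cases v) auto
    then show "edge v \<in> path_edges (path v)"
      using path_edges_append[of v] by (auto simp: edge_def path_def)
    show "length (path v) = n" using len(2)[OF v] by (simp add: path_def)
  qed
  have edge_inj: "edge v \<noteq> edge w" if "v \<in> I" "w \<in> I" "v \<noteq> w" for v w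
    using len(1)[OF that(1)] len(1)[OF that(2)] that(3) by (cases v; cases w) (auto simp: edge_def)
  have sum_I: "(\<Sum>v\<in>I. f v) = (\<Sum>k=1..n. \<Sum>v\<in>labels b k. f v)" for f :: "nat list \<Rightarrow> real"
    unfolding I_def by (intro sum.UNION_disjoint) (auto dest: length_labels)
  have A'_box: "box (ancestors v) {edge v} (A' v)" for v
    unfolding A'_def using box_Int[OF box_in_tree[of v T] box_D[of "{edge v}" "{(1 + \<epsilon>) * y <..}"]] by simp
  have A'_prob: "prob (A' v) = prob (in_tree T v) * ?g" for v
    unfolding A'_def by (subst prob_in_tree_D) auto
  have A_prob: "prob (A v) = prob (in_tree T v) * ?g * ?h ^ (n - 1)" if "v \<in> I" for v
  proof -
    have "prob (A v) = prob (A' v) * prob {\<omega> \<in> space M.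
        \<forall>e\<in>path_edges (path v) - {edge v}. D (fst e) (snd e) \<omega> \<in> {- (\<epsilon> * y / n)..}}"
      unfolding A_def by (intro box_indep[OF A'_box box_D]) auto
    also have "\<dots> = prob (A' v) * ?h ^ card (path_edges (path v) - {edge v})"
      by (subst prob_D) auto
    finally show ?thesis
      using edge[OF that] by (simp add: A'_prob card_path_edges)
  qed
  have A_sets: "A v \<in> sets M" for v
    unfolding A_def using box_sets[OF A'_box] box_sets[OF box_D] by auto
  have A_pair: "prob (A v \<inter> A w) \<le> prob (in_tree T v \<inter> in_tree T w) * ?g\<^sup>2"
    if "v \<in> I" "w \<in> I" "v \<noteq> w" for v w
  proof -
    have "card {edge v, edge w} = 2" using edge_inj[OF that] by auto
    moreover have "prob (in_tree T v \<inter> in_tree T w \<inter>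
        {\<omega> \<in> space M. \<forall>e\<in>{edge v, edge w}. D (fst e) (snd e) \<omega> \<in> {(1 + \<epsilon>) * y <..}})
      = prob (in_tree T v \<inter> in_tree T w) * ?g ^ card {edge v, edge w}"
      using box_indep[OF box_Int[OF box_in_tree[of v T] box_in_tree[of w T]]
          box_D[of "{edge v, edge w}" "{(1 + \<epsilon>) * y <..}"]]
        prob_D[of "{edge v, edge w}" "{(1 + \<epsilon>) * y <..}"] by simp
    moreover have "prob (A v \<inter> A w) \<le> prob (in_tree T v \<inter> in_tree T w \<inter>
        {\<omega> \<in> space M. \<forall>e\<in>{edge v, edge w}. D (fst e) (snd e) \<omega> \<in> {(1 + \<epsilon>) * y <..}})"
      by (intro finite_measure_mono sets.Int in_tree_sets box_sets[OF box_D])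
         (auto simp: A_def A'_def)
    ultimately show ?thesis by simp
  qed
  have "(\<Sum>v\<in>I. \<Sum>w\<in>I - {v}. prob (A v \<inter> A w))
      \<le> (\<Sum>v\<in>I. \<Sum>w\<in>I - {v}. prob (in_tree T v \<inter> in_tree T w) * ?g\<^sup>2)"
    by (intro sum_mono A_pair) auto
  also have "\<dots> \<le> (\<Sum>v\<in>I. \<Sum>w\<in>I. prob (in_tree T v \<inter> in_tree T w) * ?g\<^sup>2)"
    using fin by (intro sum_mono sum_mono2) auto
  also have "\<dots> = (\<Sum>k=1..n. \<Sum>l=1..n. pair_sum b T k l) * ?g\<^sup>2"
    unfolding sum_I pair_sum_def
    by (subst sum.swap) (simp add: sum_distrib_right)
  also have "\<dots> \<le> (\<Sum>k=1..n. \<Sum>l=1..n. C * \<mu> ^ (k + l)) * ?g\<^sup>2"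
    by (intro mult_right_mono sum_mono second) auto
  also have "(\<Sum>k=1..n. \<Sum>l=1..n. C * \<mu> ^ (k + l)) = C * (\<Sum>k=1..n. \<mu> ^ k)\<^sup>2"
    unfolding power2_eq_square sum_product by (simp add: sum_distrib_left power_add)
  finally have pairs: "(\<Sum>v\<in>I. \<Sum>w\<in>I - {v}. prob (A v \<inter> A w)) \<le> C * (\<Sum>k=1..n. \<mu> ^ k)\<^sup>2 * ?g\<^sup>2" .
  have "c * (\<Sum>k=1..n. \<mu> ^ k) = (\<Sum>k=1..n. c * \<mu> ^ k)"
    by (simp add: sum_distrib_left)
  also have "\<dots> \<le> (\<Sum>k=1..n. \<Sum>v\<in>labels b k. prob (in_tree T v))"
    by (intro sum_mono first) auto
  also have "\<dots> = (\<Sum>v\<in>I. prob (in_tree T v))" by (simp add: sum_I)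
  finally have "c * (\<Sum>k=1..n. \<mu> ^ k) * (?g * ?h ^ (n - 1)) \<le> (\<Sum>v\<in>I. prob (in_tree T v)) * (?g * ?h ^ (n - 1))"
    by (intro mult_right_mono) auto
  also have "\<dots> = (\<Sum>v\<in>I. prob (A v))"
    by (simp add: sum_distrib_right A_prob mult.assoc)
  finally have singles: "c * (\<Sum>k=1..n. \<mu> ^ k) * ?g * ?h ^ (n - 1) \<le> (\<Sum>v\<in>I. prob (A v))"
    by (simp add: mult.assoc)
  have "AE \<omega> in M. \<omega> \<in> (\<Union>v\<in>I. A v) \<longrightarrow> \<omega> \<in> exceeds n y"
    using AE_offspring_pos[OF pos]
  proof (eventually_elim, intro impI)
    fix \<omega> assume N: "\<forall>v. N v \<omega> \<ge> 1" and "\<omega> \<in> (\<Union>v\<in>I. A v)"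
    then obtain v where v: "v \<in> I" "\<omega> \<in> A v" by blast
    have tree: "\<omega> \<in> whole_tree v" "\<omega> \<in> space M"
      using v(2) in_tree_subset_whole_tree in_tree_subset_space by (auto simp: A_def A'_def)
    have "position D (path v) \<omega> > y"
      using v(2) edge[OF v(1)]
      by (intro position_bounds(1)[where K = "{edge v}" and n = n and \<epsilon> = \<epsilon>] y \<epsilon>) (auto simp: A_def A'_def)
    moreover have "\<omega> \<in> whole_tree (path v)"
      unfolding path_def by (rule whole_tree_replicate[OF tree(1) N])
    ultimately show "\<omega> \<in> exceeds n y"
      using edge(2)[OF v(1)] tree(2) by (auto simp: exceeds_def)
  qed
  then have "prob (\<Union>v\<in>I. A v) \<le> prob (exceeds n y)"
    by (rule finite_measure_mono_AE) measurable
  moreover have "prob (\<Union>v\<in>I. A v) \<ge> (\<Sum>v\<in>I. prob (A v)) - (\<Sum>v\<in>I. \<Sum>w\<in>I - {v}. prob (A v \<inter> A w))"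
    by (rule Bonferroni_lower[OF fin A_sets])
  ultimately show ?thesis using singles pairs by linarith
qed

end

section \<open>Pruning under the Z log Z condition\<close>

text \<open>
  The number of generations \<open>j\<close> in which an offspring number \<open>t\<close> exceeds a threshold growing like
  \<open>a\<^sup>j\<close> is of the order \<open>log t\<close>. This is how \<open>Z log Z\<close> enters.
\<close>

lemma card_powers_less:
  fixes a t :: real
  assumes a: "a > 1"
  shows "real (card {j. j < k \<and> a ^ j < t}) \<le> 1 + log_plus t / ln a"
proof -
  have "{j. j < k \<and> a ^ j < t} \<subseteq> {..nat \<lfloor>log_plus t / ln a\<rfloor>}"
  proof
    fix j assume "j \<in> {j. j < k \<and> a ^ j < t}"
    then have "a ^ j < t" by simp
    then have "a ^ j < max t 1" by simp
    then have "ln (a ^ j) \<le> ln (max t 1)" using a by (subst ln_le_cancel_iff) auto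
    then have "real j * ln a \<le> log_plus t" using a by (simp add: log_plus_def ln_realpow)
    then have "real j \<le> log_plus t / ln a" using a by (simp add: field_simps)
    then show "j \<in> {..nat \<lfloor>log_plus t / ln a\<rfloor>}" by (simp add: le_nat_floor)
  qed
  then have "card {j. j < k \<and> a ^ j < t} \<le> card {..nat \<lfloor>log_plus t / ln a\<rfloor>}"
    by (intro card_mono) auto
  then have "real (card {j. j < k \<and> a ^ j < t}) \<le> 1 + real (nat \<lfloor>log_plus t / ln a\<rfloor>)"
    by simp
  also have "real (nat \<lfloor>log_plus t / ln a\<rfloor>) \<le> log_plus t / ln a"
    using a by (intro of_nat_floor) (auto simp: log_plus_def)
  finally show ?thesis by simp
qed

context branching_data
begin

text \<open>
  Any growth rate strictly between \<open>1\<close> and \<open>\<mu>\<close> would do in place of \<open>sqrt \<mu>\<close>: the threshold has to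
  grow exponentially for \<open>sum_truncation_loss\<close>, and slower than \<open>\<mu>\<^sup>j\<close> for \<open>pair_sum_truncation_le\<close>.
\<close>

definition truncation :: "real \<Rightarrow> nat \<Rightarrow> nat set" where
  "truncation B j = {m. real m \<le> B * sqrt \<mu> ^ j}"

lemma truncated_mean_loss:
  assumes "T \<subseteq> {..b}"
  shows "\<mu> - truncated_mean b T = (\<integral>m. real m * indicator (- T) m \<partial>\<zeta>)"
proof -
  have "truncated_mean b T = (\<integral>m. real m * indicator T m \<partial>\<zeta>)"
    unfolding truncated_mean_eq using assms
    by (intro Bochner_Integration.integral_cong refl) (auto simp: indicator_def min_def)
  moreover have "integrable \<zeta> (\<lambda>m. real m * indicator T m)"
    by (rule Bochner_Integration.integrable_bound[OF integrable_\<zeta>]) (auto simp: indicator_def)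
  ultimately have "\<mu> - truncated_mean b T = (\<integral>m. real m - real m * indicator T m \<partial>\<zeta>)"
    unfolding mean_\<zeta> using integrable_\<zeta> by simp
  also have "(\<lambda>m. real m - real m * indicator T m) = (\<lambda>m. real m * indicator (- T) m)"
    by (auto simp: indicator_def)
  finally show ?thesis .
qed

text \<open>
  Exchanging sum and expectation, an offspring number \<open>m\<close> is lost in every generation where it
  exceeds the threshold: none if \<open>m \<le> B\<close>, and otherwise at most as many as \<open>card_powers_less\<close> allows. The
  bound does not depend on \<open>k\<close>.
\<close>

lemma sum_truncation_loss:
  assumes \<mu>: "\<mu> > 1" and B: "B \<ge> 1" and b: "\<And>j. j < k \<Longrightarrow> B * sqrt \<mu> ^ j \<le> real b"
    and ZlogZ: "integrable \<zeta> (\<lambda>m. real m * log_plus (real m))"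
  shows "(\<Sum>j<k. \<mu> - truncated_mean b (truncation B j))
    \<le> (\<integral>m. real m * (1 + log_plus (real m) / ln (sqrt \<mu>)) * indicator {m. real m > B} m \<partial>\<zeta>)"
proof -
  let ?a = "sqrt \<mu>"
  have int: "integrable \<zeta> (\<lambda>m. real m * (1 + log_plus (real m) / ln ?a))"
    using integrable_\<zeta> ZlogZ by (simp add: ring_distribs)
  have int': "integrable \<zeta> (\<lambda>m. real m * indicator A m)" for A
    by (rule Bochner_Integration.integrable_bound[OF integrable_\<zeta>]) (auto simp: indicator_def)
  have a: "?a > 1" using \<mu> by simp
  have lp: "log_plus (real m) \<ge> 0" for m by (simp add: log_plus_def)
  have "(\<Sum>j<k. \<mu> - truncated_mean b (truncation B j))
      = (\<Sum>j<k. \<integral>m. real m * indicator (- truncation B j) m \<partial>\<zeta>)"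
  proof (intro sum.cong refl truncated_mean_loss)
    fix j assume "j \<in> {..<k}"
    then show "truncation B j \<subseteq> {..b}" using b[of j] by (auto simp: truncation_def)
  qed
  also have "\<dots> = (\<integral>m. (\<Sum>j<k. real m * indicator (- truncation B j) m) \<partial>\<zeta>)"
    by (intro Bochner_Integration.integral_sum[symmetric] int')
  also have "\<dots> \<le> (\<integral>m. real m * (1 + log_plus (real m) / ln ?a) * indicator {m. real m > B} m \<partial>\<zeta>)"
  proof (intro integral_mono)
    fix m
    have "(\<Sum>j<k. indicator (- truncation B j) m :: real) = (\<Sum>j<k. if B * ?a ^ j < real m then 1 else 0)"
      by (intro sum.cong) (auto simp: truncation_def indicator_def)
    also have "\<dots> = real (card {j. j < k \<and> B * ?a ^ j < real m})"
      by (simp add: sum.If_cases Int_def)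
    also have "\<dots> \<le> (1 + log_plus (real m) / ln ?a) * indicator {m. real m > B} m"
    proof (cases "real m > B")
      case True
      have "{j. j < k \<and> B * ?a ^ j < real m} \<subseteq> {j. j < k \<and> ?a ^ j < real m}"
      proof safe
        fix j assume "B * ?a ^ j < real m"
        moreover have "1 * ?a ^ j \<le> B * ?a ^ j" using B \<mu> by (intro mult_right_mono) auto
        ultimately show "?a ^ j < real m" by simp
      qed
      then have "card {j. j < k \<and> B * ?a ^ j < real m} \<le> card {j. j < k \<and> ?a ^ j < real m}"
        by (intro card_mono) auto
      then show ?thesis using card_powers_less[OF a, of k "real m"] True by simp
    next
      case False
      have "\<not> B * ?a ^ j < real m" for j
      proof -
        have "B * 1 \<le> B * ?a ^ j" using B a by (intro mult_left_mono one_le_power) auto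
        then show ?thesis using False by simp
      qed
      then show ?thesis using False by simp
    qed
    finally have "real m * (\<Sum>j<k. indicator (- truncation B j) m)
        \<le> real m * ((1 + log_plus (real m) / ln ?a) * indicator {m. real m > B} m)"
      by (rule mult_left_mono) simp
    then show "(\<Sum>j<k. real m * indicator (- truncation B j) m)
        \<le> real m * (1 + log_plus (real m) / ln ?a) * indicator {m. real m > B} m"
      by (simp add: sum_distrib_left mult.assoc)
  next
    show "integrable \<zeta> (\<lambda>m. real m * (1 + log_plus (real m) / ln ?a) * indicator {m. real m > B} m)"
      by (rule Bochner_Integration.integrable_bound[OF int]) (auto simp: indicator_def)
  qed (intro Bochner_Integration.integrable_sum int')
  finally show ?thesis .
qed

text \<open>
  The expected size of generation \<open>k\<close> of the pruned tree is the product of \<open>k\<close> truncated means. Its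
  ratio to \<open>\<mu>\<^sup>k\<close> is at least one minus the sum of the relative losses (the Weierstrass product
  inequality), and this sum tends to \<open>0\<close> as \<open>B\<close> grows, by dominated convergence.
\<close>

lemma prob_truncated_tree_ge:
  assumes \<mu>: "\<mu> > 1" and \<eta>: "\<eta> > 0"
    and ZlogZ: "integrable \<zeta> (\<lambda>m. real m * log_plus (real m))"
  shows "\<exists>B\<ge>1. \<forall>k b. (\<forall>j<k. B * sqrt \<mu> ^ j \<le> real b) \<longrightarrow>
    (1 - \<eta>) * \<mu> ^ k \<le> (\<Sum>v\<in>labels b k. prob (in_tree (truncation B) v))"
proof -
  let ?\<phi> = "\<lambda>m. real m * (1 + log_plus (real m) / ln (sqrt \<mu>))"
  have int: "integrable \<zeta> ?\<phi>"
    using integrable_\<zeta> ZlogZ by (simp add: ring_distribs)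
  have "(\<lambda>B. \<integral>m. ?\<phi> m * indicator {m. real m > real B} m \<partial>\<zeta>) \<longlonglongrightarrow> (\<integral>m. 0 \<partial>\<zeta>)"
  proof (rule integral_dominated_convergence[where w = "\<lambda>m. norm (?\<phi> m)"])
    show "AE m in \<zeta>. (\<lambda>B. ?\<phi> m * indicator {m. real m > real B} m) \<longlonglongrightarrow> 0"
    proof (rule AE_I2)
      fix m
      have "eventually (\<lambda>B. ?\<phi> m * indicator {m. real m > real B} m = 0) sequentially"
        using eventually_ge_at_top[of m] by eventually_elim simp
      then show "(\<lambda>B. ?\<phi> m * indicator {m. real m > real B} m) \<longlonglongrightarrow> 0"
        by (rule tendsto_eventually)
    qed
  qed (use int in \<open>auto simp: indicator_def\<close>)
  then have "eventually (\<lambda>B. (\<integral>m. ?\<phi> m * indicator {m. real m > real B} m \<partial>\<zeta>) < \<eta> * \<mu>) sequentially"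
    using \<mu> \<eta> by (intro order_tendstoD) auto
  then have "eventually (\<lambda>B. B \<ge> 1 \<and> (\<integral>m. ?\<phi> m * indicator {m. real m > real B} m \<partial>\<zeta>) < \<eta> * \<mu>) sequentially"
    by (intro eventually_conj eventually_ge_at_top)
  then obtain B :: nat where B: "B \<ge> 1"
    and small: "(\<integral>m. ?\<phi> m * indicator {m. real m > real B} m \<partial>\<zeta>) < \<eta> * \<mu>"
    by (auto simp: eventually_at_top_linorder)
  show ?thesis
  proof (intro exI[of _ "real B"] conjI allI impI)
    fix k b assume b: "\<forall>j<k. real B * sqrt \<mu> ^ j \<le> real b"
    let ?x = "\<lambda>j. 1 - truncated_mean b (truncation B j) / \<mu>"
    have "(\<Sum>j<k. \<mu> - truncated_mean b (truncation B j)) \<le> \<eta> * \<mu>"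
      using sum_truncation_loss[OF \<mu> _ _ ZlogZ, of "real B" k b] B b small by auto
    moreover have "(\<Sum>j<k. ?x j) = (\<Sum>j<k. \<mu> - truncated_mean b (truncation B j)) / \<mu>"
      using \<mu> by (simp add: sum_divide_distrib diff_divide_distrib)
    ultimately have "(\<Sum>j<k. ?x j) \<le> \<eta>"
      using \<mu> by (simp add: divide_le_eq)
    moreover have "1 - (\<Sum>j<k. ?x j) \<le> (\<Prod>j<k. 1 - ?x j)"
      using \<mu> truncated_mean_le truncated_mean_nonneg
      by (intro Weierstrass_prod_ineq) (auto simp: divide_le_eq)
    ultimately have "1 - \<eta> \<le> (\<Prod>j<k. truncated_mean b (truncation B j) / \<mu>)"
      by simp
    then show "(1 - \<eta>) * \<mu> ^ k \<le> (\<Sum>v\<in>labels b k. prob (in_tree (truncation B) v))"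
      using \<mu> by (simp add: sum_prob_in_tree prod_dividef pos_le_divide_eq)
  qed (use B in auto)
qed

text \<open>
  On the diagonal, \<open>pair_sum_Suc_Suc\<close> increases the ratio of \<open>pair_sum\<close> to \<open>\<mu>\<^sup>2\<^sup>k\<close> by a multiple of
  \<open>(1 / sqrt \<mu>)\<^sup>k\<close>, which is summable. Off the diagonal, \<open>pair_sum_Suc\<close> continues from the diagonal.
\<close>

lemma pair_sum_truncation_le:
  assumes \<mu>: "\<mu> > 1" and B: "B \<ge> 1"
  shows "\<exists>C. \<forall>b k l. pair_sum b (truncation B) k l \<le> C * \<mu> ^ (k + l)"
proof -
  let ?a = "1 / sqrt \<mu>" and ?T = "truncation B"
  define C where "C = 1 + B / \<mu> * (1 / (1 - ?a))"
  have a: "0 < ?a" "?a < 1" using \<mu> by auto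
  have diag: "pair_sum b ?T k k \<le> (1 + B / \<mu> * (\<Sum>j<k. ?a ^ j)) * \<mu> ^ (2 * k)" for b k
  proof (induction k)
    case 0
    show ?case by (simp add: pair_sum_def prob_space)
  next
    case (Suc k)
    have "pair_sum b ?T (Suc k) (Suc k) \<le> \<mu>\<^sup>2 * pair_sum b ?T k k + (B * sqrt \<mu> ^ k) * \<mu> * \<mu> ^ k"
      using \<mu> B by (intro pair_sum_Suc_Suc) (auto simp: truncation_def)
    also have "\<dots> \<le> \<mu>\<^sup>2 * ((1 + B / \<mu> * (\<Sum>j<k. ?a ^ j)) * \<mu> ^ (2 * k)) + (B * sqrt \<mu> ^ k) * \<mu> * \<mu> ^ k"
      using Suc by (intro add_right_mono mult_left_mono) auto
    also have "(B * sqrt \<mu> ^ k) * \<mu> * \<mu> ^ k = \<mu>\<^sup>2 * (B / \<mu> * ?a ^ k) * \<mu> ^ (2 * k)"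
    proof -
      have "\<mu> ^ k * ?a ^ k = sqrt \<mu> ^ k"
        using \<mu> by (simp add: power_mult_distrib[symmetric] real_div_sqrt)
      moreover have "\<mu>\<^sup>2 * (B / \<mu> * ?a ^ k) * \<mu> ^ (2 * k) = \<mu> * B * (\<mu> ^ k * ?a ^ k) * \<mu> ^ k"
        using \<mu> by (simp add: power2_eq_square mult_2 power_add)
      ultimately show ?thesis by simp
    qed
    also have "\<mu>\<^sup>2 * ((1 + B / \<mu> * (\<Sum>j<k. ?a ^ j)) * \<mu> ^ (2 * k)) + \<mu>\<^sup>2 * (B / \<mu> * ?a ^ k) * \<mu> ^ (2 * k)
        = (1 + B / \<mu> * (\<Sum>j<Suc k. ?a ^ j)) * \<mu> ^ (2 * Suc k)"
      by (simp add: algebra_simps power2_eq_square)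
    finally show ?case .
  qed
  have diag_C: "pair_sum b ?T k k \<le> C * \<mu> ^ (k + k)" for b k
  proof -
    have "(\<Sum>j<k. ?a ^ j) \<le> (\<Sum>j. ?a ^ j)"
      using a by (intro sum_le_suminf summable_geometric) auto
    also have "\<dots> = 1 / (1 - ?a)" using a by (intro suminf_geometric) auto
    finally have "(1 + B / \<mu> * (\<Sum>j<k. ?a ^ j)) * \<mu> ^ (2 * k) \<le> C * \<mu> ^ (2 * k)"
      unfolding C_def using \<mu> B by (intro mult_right_mono add_left_mono mult_left_mono) auto
    then show ?thesis using diag[of b k] by (simp add: mult_2)
  qed
  have le: "pair_sum b ?T k l \<le> C * \<mu> ^ (k + l)" if "k \<le> l" for b k l
    using that
  proof (induction l rule: dec_induct)
    case base
    show ?case by (rule diag_C)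
  next
    case (step l)
    have "pair_sum b ?T k (Suc l) \<le> \<mu> * pair_sum b ?T k l" using step by (intro pair_sum_Suc)
    also have "\<dots> \<le> \<mu> * (C * \<mu> ^ (k + l))" using \<mu> step by (intro mult_left_mono) auto
    finally show ?case by (simp add: mult_ac)
  qed
  have "pair_sum b ?T k l \<le> C * \<mu> ^ (k + l)" for b k l
  proof (cases "k \<le> l")
    case False
    then show ?thesis using le[of l k b] by (simp add: pair_sum_commute[of b ?T k l] add.commute)
  qed (rule le)
  then show ?thesis by blast
qed

end

section \<open>Regularly varying tails\<close>

locale regularly_varying_tail =
  fixes F :: "real \<Rightarrow> real" and \<alpha> :: real
  assumes F_antimono: "s \<le> t \<Longrightarrow> F t \<le> F s" and F_nonneg: "F t \<ge> 0" and F_le_1: "F t \<le> 1"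
    and \<alpha>_pos: "\<alpha> > 0"
    and F_ratio: "c > 0 \<Longrightarrow> ((\<lambda>t. F (c * t) / F t) \<longlongrightarrow> c powr (- \<alpha>)) at_top"
begin

text \<open>
  If \<open>F\<close> vanished somewhere, it would vanish eventually, and the ratios \<open>0 / 0 = 0\<close> could not tend to
  a positive number.
\<close>

lemma F_pos: "F t > 0"
proof (rule ccontr)
  assume "\<not> F t > 0"
  then have "F s = 0" if "s \<ge> t" for s
    using F_antimono[OF that] F_nonneg[of s] by simp
  then have "eventually (\<lambda>s. F (1 * s) / F s = 0) at_top"
    by (auto simp: eventually_at_top_linorder)
  then have "((\<lambda>s. F (1 * s) / F s) \<longlongrightarrow> 0) at_top" by (rule tendsto_eventually)
  moreover have "((\<lambda>s. F (1 * s) / F s) \<longlongrightarrow> 1 powr (- \<alpha>)) at_top" by (rule F_ratio) simp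
  ultimately have "(0::real) = 1 powr (- \<alpha>)" by (intro tendsto_unique) simp_all
  then show False by simp
qed

lemma F_doubling: "\<exists>C. \<forall>t>0. F (t / 2) \<le> C * F t"
proof -
  have "eventually (\<lambda>t. F (1 / 2 * t) / F t < (1 / 2) powr (- \<alpha>) + 1) at_top"
    by (rule order_tendstoD(2)[OF F_ratio]) auto
  then obtain t0 where t0: "\<And>t. t \<ge> t0 \<Longrightarrow> F (1 / 2 * t) / F t < (1 / 2) powr (- \<alpha>) + 1"
    by (auto simp: eventually_at_top_linorder)
  define C where "C = max ((1 / 2) powr (- \<alpha>) + 1) (1 / F t0)"
  have "F (t / 2) \<le> C * F t" for t
  proof (cases "t \<ge> t0")
    case True
    then have "F (t / 2) \<le> ((1 / 2) powr (- \<alpha>) + 1) * F t"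
      using t0[OF True] F_pos[of t] by (simp add: divide_less_eq)
    also have "\<dots> \<le> C * F t" using F_pos[of t] by (intro mult_right_mono) (auto simp: C_def)
    finally show ?thesis .
  next
    case False
    have "F (t / 2) \<le> 1 / F t0 * F t0" using F_pos[of t0] F_le_1 by simp
    also have "\<dots> \<le> C * F t"
      using False F_pos[of t0] F_antimono[of t t0]
      by (intro mult_mono) (auto simp: C_def le_max_iff_disj)
    finally show ?thesis .
  qed
  then show ?thesis by blast
qed

text \<open>
  A weak form of the Potter bounds, by iterating \<open>F_doubling\<close> about \<open>log\<^sub>2 s\<close> times. The exponent is
  far from optimal, but any polynomial is beaten by the exponential decay of \<open>F (\<gamma> n)\<close>.
\<close>

lemma F_polynomial_bound: "\<exists>m::nat. \<forall>s\<ge>1. \<forall>t>0. F (t / s) \<le> (2 * s) ^ m * F t"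
proof -
  obtain C where C: "\<And>t. t > 0 \<Longrightarrow> F (t / 2) \<le> C * F t" using F_doubling by blast
  obtain m :: nat where m: "C \<le> 2 ^ m"
    using real_arch_pow[of 2 C] by (auto intro: less_imp_le)
  have C': "F (t / 2) \<le> 2 ^ m * F t" if "t > 0" for t
    using C[OF that] m F_pos[of t] by (meson mult_right_mono less_imp_le order_trans)
  have pow: "F (t / 2 ^ k) \<le> (2 ^ k) ^ m * F t" if "t > 0" for t k
  proof (induction k)
    case (Suc k)
    have "F (t / 2 ^ k / 2) \<le> 2 ^ m * F (t / 2 ^ k)" using that by (intro C') auto
    also have "\<dots> \<le> 2 ^ m * ((2 ^ k) ^ m * F t)" by (intro mult_left_mono Suc) auto
    finally show ?case by (simp add: power_mult_distrib mult_ac)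
  qed simp
  have "F (t / s) \<le> (2 * s) ^ m * F t" if s: "s \<ge> 1" and t: "t > 0" for s t
  proof -
    define k where "k = nat \<lceil>log 2 s\<rceil>"
    have k: "log 2 s \<le> real k" "real k < log 2 s + 1"
      using s ceiling_correct[of "log 2 s"] unfolding k_def by (auto simp: real_nat_ceiling_ge)
    have "s \<le> 2 ^ k" using k(1) s by (simp add: log_le_iff powr_realpow)
    moreover have "2 ^ k \<le> 2 * s"
    proof -
      have "(2::real) ^ k = 2 powr real k" by (simp add: powr_realpow)
      also have "\<dots> \<le> 2 powr (log 2 s + 1)" using k(2) by (intro powr_mono) auto
      also have "\<dots> = 2 * s" using s by (simp add: powr_add)
      finally show ?thesis .
    qed
    ultimately have "t / 2 ^ k \<le> t / s" and "((2 ^ k) ^ m :: real) \<le> (2 * s) ^ m"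
      using s t by (intro divide_left_mono power_mono; simp)+
    then have "F (t / s) \<le> F (t / 2 ^ k)" "(2 ^ k) ^ m * F t \<le> (2 * s) ^ m * F t"
      using F_pos[of t] F_antimono by (auto intro!: mult_right_mono)
    then show ?thesis using pow[OF t, of k] by linarith
  qed
  then show ?thesis by blast
qed

end

text \<open>
  The sequence \<open>b n\<close> consists of the quantiles of the tail \<open>F\<close> at level \<open>\<mu>\<^sup>-\<^sup>n\<close>, and \<open>\<gamma> n\<close> is of larger
  order.
\<close>

locale threshold_sequence = regularly_varying_tail +
  fixes \<gamma> b :: "nat \<Rightarrow> real" and \<mu> :: real
  assumes \<mu>: "\<mu> > 1"
    and F_at_top: "(F \<longlongrightarrow> 0) at_top"
    and b: "\<And>n. n \<ge> 1 \<Longrightarrow> b n = Inf {x. F x \<le> 1 / \<mu> ^ n}"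
    and \<gamma>: "\<And>n. n \<ge> 1 \<Longrightarrow> \<gamma> n > 0"
    and b_\<gamma>: "(\<lambda>n. b n / \<gamma> n) \<longlonglongrightarrow> 0"
begin

lemma quantile_set: "{x. F x \<le> 1 / \<mu> ^ n} \<noteq> {}"
proof -
  have "eventually (\<lambda>x. F x < 1 / \<mu> ^ n) at_top"
    using \<mu> by (intro order_tendstoD(2)[OF F_at_top]) auto
  then obtain x where "F x < 1 / \<mu> ^ n"
    using eventually_happens'[OF trivial_limit_at_top_linorder] by blast
  then show ?thesis by (auto intro: less_imp_le)
qed

lemma b_at_top: "filterlim b at_top sequentially"
  unfolding filterlim_at_top
proof
  fix t
  have "(\<lambda>n. (1 / \<mu>) ^ n) \<longlonglongrightarrow> 0" using \<mu> by (intro LIMSEQ_power_zero) auto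
  then have "eventually (\<lambda>n. (1 / \<mu>) ^ n < F t) sequentially"
    using F_pos by (rule order_tendstoD)
  then show "eventually (\<lambda>n. t \<le> b n) sequentially"
    using eventually_ge_at_top[of 1]
  proof eventually_elim
    case (elim n)
    show ?case
      unfolding b[OF elim(2)]
    proof (rule cInf_greatest[OF quantile_set])
      fix x assume "x \<in> {x. F x \<le> 1 / \<mu> ^ n}"
      then have "F x < F t" using elim by (simp add: power_one_over)
      then show "t \<le> x" using F_antimono[of x t] by (cases "x \<le> t") auto
    qed
  qed
qed

lemma b_less_\<gamma>:
  assumes "\<kappa> > 0"
  shows "eventually (\<lambda>n. \<kappa> * b n < \<gamma> n) sequentially"
proof -
  have "eventually (\<lambda>n. b n / \<gamma> n < 1 / \<kappa>) sequentially"
    using assms by (intro order_tendstoD(2)[OF b_\<gamma>]) auto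
  then show ?thesis
    using eventually_ge_at_top[of 1]
  proof eventually_elim
    case (elim n)
    then show ?case using \<gamma>[OF elim(2)] assms by (simp add: field_simps)
  qed
qed

lemma \<gamma>_at_top: "filterlim \<gamma> at_top sequentially"
  by (rule filterlim_at_top_mono[OF b_at_top])
     (use b_less_\<gamma>[of 1] in \<open>auto elim!: eventually_mono\<close>)

text \<open>
  For every \<open>\<kappa> \<ge> 1\<close>, eventually \<open>\<gamma> n / \<kappa>\<close> exceeds the quantile \<open>b n\<close>, so \<open>\<mu>\<^sup>n F (\<gamma> n / \<kappa>) \<le> 1\<close>; regular
  variation turns the factor \<open>\<kappa>\<close> in the argument into a factor \<open>\<kappa>\<^sup>-\<^sup>\<alpha>\<close>, which is arbitrarily small.
\<close>

lemma tail_at_\<gamma>_small: "(\<lambda>n. \<mu> ^ n * F (\<gamma> n)) \<longlonglongrightarrow> 0"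
proof (rule order_tendstoI)
  fix e :: real assume e: "e < 0"
  have "\<mu> ^ n * F (\<gamma> n) \<ge> 0" for n using \<mu> F_nonneg by simp
  then show "eventually (\<lambda>n. e < \<mu> ^ n * F (\<gamma> n)) sequentially"
    using e by (auto intro: always_eventually less_le_trans)
next
  fix e :: real assume e: "e > 0"
  have "((\<lambda>\<kappa>. 2 * \<kappa> powr (- \<alpha>)) \<longlongrightarrow> 2 * 0) at_top"
    using \<alpha>_pos by (intro tendsto_mult tendsto_const tendsto_neg_powr filterlim_ident) auto
  then have "eventually (\<lambda>\<kappa>. 2 * \<kappa> powr (- \<alpha>) < e) at_top"
    using e by (intro order_tendstoD(2)) auto
  then have "eventually (\<lambda>\<kappa>. 2 * \<kappa> powr (- \<alpha>) < e \<and> \<kappa> \<ge> 1) at_top"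
    by (intro eventually_conj eventually_ge_at_top)
  then obtain \<kappa> :: real where \<kappa>: "2 * \<kappa> powr (- \<alpha>) < e" "\<kappa> \<ge> 1"
    by (auto simp: eventually_at_top_linorder)
  have "filterlim (\<lambda>n. 1 / \<kappa> * \<gamma> n) at_top sequentially"
    using \<kappa> by (intro filterlim_tendsto_pos_mult_at_top[OF tendsto_const _ \<gamma>_at_top]) auto
  from filterlim_compose[OF F_ratio[of \<kappa>] this] \<kappa>
  have "(\<lambda>n. F (\<gamma> n) / F (\<gamma> n / \<kappa>)) \<longlonglongrightarrow> \<kappa> powr (- \<alpha>)" by simp
  moreover have "\<kappa> powr (- \<alpha>) < 2 * \<kappa> powr (- \<alpha>)" using \<kappa> by simp
  ultimately have "eventually (\<lambda>n. F (\<gamma> n) / F (\<gamma> n / \<kappa>) < 2 * \<kappa> powr (- \<alpha>)) sequentially"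
    by (rule order_tendstoD(2))
  moreover have "eventually (\<lambda>n. \<kappa> * b n < \<gamma> n) sequentially" using \<kappa> by (intro b_less_\<gamma>) auto
  ultimately show "eventually (\<lambda>n. \<mu> ^ n * F (\<gamma> n) < e) sequentially"
    using eventually_ge_at_top[of 1]
  proof eventually_elim
    case (elim n)
    have "Inf {x. F x \<le> 1 / \<mu> ^ n} < \<gamma> n / \<kappa>"
      using elim(2) b[OF elim(3)] \<kappa> by (simp add: field_simps)
    then obtain x where x: "F x \<le> 1 / \<mu> ^ n" "x < \<gamma> n / \<kappa>"
      using cInf_lessD[OF quantile_set] by blast
    then have "F (\<gamma> n / \<kappa>) \<le> 1 / \<mu> ^ n" using F_antimono[of x "\<gamma> n / \<kappa>"] by simp
    then have le: "\<mu> ^ n * F (\<gamma> n / \<kappa>) \<le> 1" using \<mu> by (simp add: field_simps)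
    have "F (\<gamma> n) < 2 * \<kappa> powr (- \<alpha>) * F (\<gamma> n / \<kappa>)"
      using elim(1) F_pos[of "\<gamma> n / \<kappa>"] by (simp add: divide_less_eq)
    then have "\<mu> ^ n * F (\<gamma> n) \<le> \<mu> ^ n * (2 * \<kappa> powr (- \<alpha>) * F (\<gamma> n / \<kappa>))"
      using \<mu> by (intro mult_left_mono) auto
    also have "\<dots> = 2 * \<kappa> powr (- \<alpha>) * (\<mu> ^ n * F (\<gamma> n / \<kappa>))" by simp
    also have "\<dots> \<le> 2 * \<kappa> powr (- \<alpha>) * 1" by (intro mult_left_mono le) auto
    finally show ?case using \<kappa> by simp
  qed
qed

text \<open>
  By \<open>F_polynomial_bound\<close> the medium jumps are at most polynomially more likely than jumps above
  \<open>\<gamma> n\<close>, and eventually \<open>F (\<gamma> n) \<le> \<mu>\<^sup>-\<^sup>n\<close>.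
\<close>

lemma two_jumps_negligible:
  assumes c: "c > 0"
  shows "(\<lambda>n. (real n)\<^sup>2 * (F (c * \<gamma> n / n))\<^sup>2 / F (\<gamma> n)) \<longlonglongrightarrow> 0" (is "?A \<longlonglongrightarrow> 0")
    and "(\<lambda>n. real n * F (c * \<gamma> n / n)) \<longlonglongrightarrow> 0" (is "?B \<longlonglongrightarrow> 0")
proof -
  obtain m :: nat where m: "\<And>s t. s \<ge> 1 \<Longrightarrow> t > 0 \<Longrightarrow> F (t / s) \<le> (2 * s) ^ m * F t"
    using F_polynomial_bound by blast
  have ev: "eventually (\<lambda>n. n \<ge> 1 \<and> real n \<ge> c \<and> \<mu> ^ n * F (\<gamma> n) < 1) sequentially"
    using order_tendstoD(2)[OF tail_at_\<gamma>_small zero_less_one] eventually_ge_at_top[of "nat \<lceil>c\<rceil>"] eventually_ge_at_top[of "1::nat"]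
    by eventually_elim linarith
  have bound: "F (c * \<gamma> n / n) \<le> (2 * (n / c)) ^ m * F (\<gamma> n)" "F (\<gamma> n) \<le> (1 / \<mu>) ^ n"
    if "n \<ge> 1 \<and> real n \<ge> c \<and> \<mu> ^ n * F (\<gamma> n) < 1" for n
  proof -
    have "c * \<gamma> n / n = \<gamma> n / (n / c)" by simp
    moreover have "real n / c \<ge> 1" using that c by simp
    ultimately show "F (c * \<gamma> n / n) \<le> (2 * (n / c)) ^ m * F (\<gamma> n)"
      using m[of "n / c" "\<gamma> n"] \<gamma>[of n] that by (simp only:)
    show "F (\<gamma> n) \<le> (1 / \<mu>) ^ n"
      using that \<mu> by (simp add: power_one_over field_simps)
  qed
  have lim: "(\<lambda>n. real n ^ j * (2 * (n / c)) ^ k * (1 / \<mu>) ^ n) \<longlonglongrightarrow> 0" for j k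
    using \<mu> c by real_asymp
  show "?A \<longlonglongrightarrow> 0"
  proof (rule tendsto_sandwich[OF _ _ tendsto_const lim[of 2 "2 * m"]])
    show "eventually (\<lambda>n. 0 \<le> ?A n) sequentially"
      using F_nonneg by (intro always_eventually) auto
    show "eventually (\<lambda>n. ?A n \<le> real n ^ 2 * (2 * (n / c)) ^ (2 * m) * (1 / \<mu>) ^ n) sequentially"
      using ev
    proof eventually_elim
      case (elim n)
      have "(F (c * \<gamma> n / n))\<^sup>2 \<le> ((2 * (n / c)) ^ m * F (\<gamma> n))\<^sup>2"
        using bound(1)[OF elim] F_nonneg by (intro power_mono) auto
      also have "\<dots> = (2 * (n / c)) ^ (2 * m) * F (\<gamma> n) * F (\<gamma> n)"
        by (simp add: power_mult_distrib power2_eq_square power_mult[symmetric] mult.commute[of 2] power_mult power_add mult_2)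
      finally have "(F (c * \<gamma> n / n))\<^sup>2 / F (\<gamma> n) \<le> (2 * (n / c)) ^ (2 * m) * F (\<gamma> n)"
        using F_pos[of "\<gamma> n"] by (simp add: divide_le_eq)
      also have "\<dots> \<le> (2 * (n / c)) ^ (2 * m) * (1 / \<mu>) ^ n"
        using c by (intro mult_left_mono bound(2)[OF elim]) auto
      finally have "real n ^ 2 * ((F (c * \<gamma> n / n))\<^sup>2 / F (\<gamma> n))
          \<le> real n ^ 2 * ((2 * (n / c)) ^ (2 * m) * (1 / \<mu>) ^ n)"
        by (intro mult_left_mono) auto
      then show ?case by (simp add: mult.assoc)
    qed
  qed
  show "?B \<longlonglongrightarrow> 0"
  proof (rule tendsto_sandwich[OF _ _ tendsto_const lim[of 1 m]])
    show "eventually (\<lambda>n. 0 \<le> ?B n) sequentially"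
      using F_nonneg by (intro always_eventually) auto
    show "eventually (\<lambda>n. ?B n \<le> real n ^ 1 * (2 * (n / c)) ^ m * (1 / \<mu>) ^ n) sequentially"
      using ev
    proof eventually_elim
      case (elim n)
      note bound(1)[OF elim]
      also have "(2 * (n / c)) ^ m * F (\<gamma> n) \<le> (2 * (n / c)) ^ m * (1 / \<mu>) ^ n"
        using c by (intro mult_left_mono bound(2)[OF elim]) auto
      finally have "real n * F (c * \<gamma> n / n) \<le> real n * ((2 * (n / c)) ^ m * (1 / \<mu>) ^ n)"
        by (intro mult_left_mono) auto
      then show ?case by (simp add: mult.assoc)
    qed
  qed
qed

end

section \<open>The limit\<close>

lemma tendsto_sandwich_family:
  fixes a :: "nat \<Rightarrow> real" and l u :: "real \<Rightarrow> real"
  assumes lower: "\<And>\<epsilon>. 0 < \<epsilon> \<Longrightarrow> \<epsilon> < 1 \<Longrightarrow> \<exists>f. f \<longlonglongrightarrow> l \<epsilon> \<and> eventually (\<lambda>n. f n \<le> a n) sequentially"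
    and upper: "\<And>\<epsilon>. 0 < \<epsilon> \<Longrightarrow> \<epsilon> < 1 \<Longrightarrow> \<exists>f. f \<longlonglongrightarrow> u \<epsilon> \<and> eventually (\<lambda>n. a n \<le> f n) sequentially"
    and l: "(l \<longlongrightarrow> c) (at_right 0)" and u: "(u \<longlongrightarrow> c) (at_right 0)"
  shows "a \<longlonglongrightarrow> c"
proof (rule order_tendstoI)
  have small: "eventually (\<lambda>\<epsilon>::real. 0 < \<epsilon> \<and> \<epsilon> < 1) (at_right 0)"
    by (auto simp: eventually_at_right_field intro: exI[of _ 1])
  {
    fix y assume "y < c"
    then have "eventually (\<lambda>\<epsilon>. y < l \<epsilon> \<and> 0 < \<epsilon> \<and> \<epsilon> < 1) (at_right 0)"
      by (intro eventually_conj small order_tendstoD(1)[OF l])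
    then obtain \<epsilon> where \<epsilon>: "y < l \<epsilon>" "0 < \<epsilon>" "\<epsilon> < 1"
      using eventually_happens'[OF trivial_limit_at_right_real] by blast
    obtain f where f: "f \<longlonglongrightarrow> l \<epsilon>" "eventually (\<lambda>n. f n \<le> a n) sequentially"
      using lower \<epsilon> by blast
    show "eventually (\<lambda>n. y < a n) sequentially"
      using order_tendstoD(1)[OF f(1) \<epsilon>(1)] f(2) by eventually_elim simp
  next
    fix y assume "c < y"
    then have "eventually (\<lambda>\<epsilon>. u \<epsilon> < y \<and> 0 < \<epsilon> \<and> \<epsilon> < 1) (at_right 0)"
      by (intro eventually_conj small order_tendstoD(2)[OF u])
    then obtain \<epsilon> where \<epsilon>: "u \<epsilon> < y" "0 < \<epsilon>" "\<epsilon> < 1"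
      using eventually_happens'[OF trivial_limit_at_right_real] by blast
    obtain f where f: "f \<longlonglongrightarrow> u \<epsilon>" "eventually (\<lambda>n. a n \<le> f n) sequentially"
      using upper \<epsilon> by blast
    show "eventually (\<lambda>n. a n < y) sequentially"
      using order_tendstoD(2)[OF f(1) \<epsilon>(1)] f(2) by eventually_elim simp
  }
qed

lemma sum_powers_limit:
  fixes \<mu> :: real
  assumes "\<mu> > 1"
  shows "(\<lambda>n. (\<Sum>k=1..n. \<mu> ^ k) / \<mu> ^ n) \<longlonglongrightarrow> \<mu> / (\<mu> - 1)"
proof -
  have eq: "(\<Sum>k=1..n. \<mu> ^ k) / \<mu> ^ n = \<mu> / (\<mu> - 1) * (1 - (1 / \<mu>) ^ n)" for n
  proof -
    have "(\<Sum>k=1..n. \<mu> ^ k) * (\<mu> - 1) = \<mu> * (\<mu> ^ n - 1)"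
      by (induction n) (simp_all add: algebra_simps)
    then have "(\<Sum>k=1..n. \<mu> ^ k) = \<mu> * (\<mu> ^ n - 1) / (\<mu> - 1)"
      using assms by (simp add: eq_divide_eq)
    also have "\<dots> / \<mu> ^ n = \<mu> / (\<mu> - 1) * (1 - (1 / \<mu>) ^ n)"
      using assms by (simp add: power_one_over divide_simps)
    finally show ?thesis .
  qed
  have "(\<lambda>n. \<mu> / (\<mu> - 1) * (1 - (1 / \<mu>) ^ n)) \<longlonglongrightarrow> \<mu> / (\<mu> - 1) * (1 - 0)"
    using assms by (intro tendsto_intros LIMSEQ_power_zero) auto
  then show ?thesis unfolding eq by simp
qed

context branching_data
begin

abbreviation abs_tail :: "real \<Rightarrow> real" where
  "abs_tail t \<equiv> measure \<xi> {x. \<bar>x\<bar> > t}"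

lemma abs_tail_sets [simp]: "{x. \<bar>x\<bar> > t} \<in> sets \<xi>"
  unfolding sets_\<xi> by measurable

lemma right_tail_le: "measure \<xi> {t<..} \<le> abs_tail t"
  by (intro \<xi>.finite_measure_mono) auto

lemma left_tail_ge: "measure \<xi> {- t..} \<ge> 1 - abs_tail t"
proof -
  have "measure \<xi> {..< - t} \<le> abs_tail t"
    by (intro \<xi>.finite_measure_mono) auto
  moreover have "measure \<xi> {- t..} = 1 - measure \<xi> {..< - t}"
    using \<xi>.prob_compl[of "{..< - t}"] by (simp add: sets_\<xi> Compl_eq_Diff_UNIV[symmetric])
  ultimately show ?thesis by simp
qed

text \<open>
  After division by \<open>\<mu>\<^sup>n p\<^sub>n\<close>, the bounds \<open>prob_exceeds_le\<close> and \<open>prob_exceeds_ge\<close> converge for each fixed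
  \<open>\<epsilon>\<close>, and their limits have a common limit as \<open>\<epsilon>\<close> tends to \<open>0\<close>. In the lower bound the same \<open>\<epsilon>\<close>
  also serves as the fraction \<open>\<eta>\<close> of particles lost by pruning.
\<close>

lemma max_position_tail:
  fixes \<alpha> q x :: real and \<gamma> b :: "nat \<Rightarrow> real"
  assumes \<mu>: "\<mu> > 1" and pos: "measure \<zeta> {1..} = 1"
    and ZlogZ: "integrable \<zeta> (\<lambda>m. real m * log_plus (real m))"
    and tail: "regularly_varying_tail abs_tail \<alpha>"
    and q: "((\<lambda>t. measure \<xi> {t<..} / abs_tail t) \<longlongrightarrow> q) at_top"
    and b: "\<And>n. n \<ge> 1 \<Longrightarrow> b n = Inf {x. abs_tail x \<le> 1 / \<mu> ^ n}"
    and \<gamma>: "\<And>n. n \<ge> 1 \<Longrightarrow> \<gamma> n > 0" and b_\<gamma>: "(\<lambda>n. b n / \<gamma> n) \<longlonglongrightarrow> 0"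
    and x: "x > 0"
  shows "(\<lambda>n. 1 / (\<mu> ^ n * abs_tail (\<gamma> n)) * prob (exceeds n (\<gamma> n * x)))
    \<longlonglongrightarrow> q * x powr (- \<alpha>) * (\<mu> / (\<mu> - 1))"
proof -
  have vanish: "(abs_tail \<longlongrightarrow> 0) at_top"
  proof -
    interpret A: real_distribution "distr \<xi> borel abs"
      by (intro \<xi>.real_distribution_distr) (simp add: measurable_cong_sets[OF sets_\<xi> refl])
    have "abs_tail t = 1 - cdf (distr \<xi> borel abs) t" for t
    proof -
      have "cdf (distr \<xi> borel abs) t = measure \<xi> (space \<xi> - {x. \<bar>x\<bar> > t})"
        unfolding cdf_def
        by (subst measure_distr) (auto simp: measurable_cong_sets[OF sets_\<xi> refl] intro!: arg_cong[of _ _ "measure \<xi>"])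
      then show ?thesis using \<xi>.prob_compl[of "{x. \<bar>x\<bar> > t}"] by simp
    qed
    moreover have "((\<lambda>t. 1 - cdf (distr \<xi> borel abs) t) \<longlongrightarrow> 1 - 1) at_top"
      by (intro tendsto_intros A.cdf_lim_at_top_prob)
    ultimately show ?thesis by simp
  qed
  interpret T: threshold_sequence abs_tail \<alpha> \<gamma> b \<mu>
    by (intro threshold_sequence.intro tail threshold_sequence_axioms.intro \<mu> vanish b \<gamma> b_\<gamma>)
  note p_pos = T.F_pos
  define p where "p n = abs_tail (\<gamma> n)" for n
  define G where "G c n = measure \<xi> {c * x * \<gamma> n <..}" for c n
  define S where "S n = (\<Sum>k=1..n. \<mu> ^ k) / \<mu> ^ n" for n
  define P where "P n = 1 / (\<mu> ^ n * p n) * prob (exceeds n (\<gamma> n * x))" for n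
  have p: "p n > 0" for n unfolding p_def by (rule p_pos)
  have S: "S \<longlonglongrightarrow> \<mu> / (\<mu> - 1)" unfolding S_def[abs_def] by (rule sum_powers_limit[OF \<mu>])
  have G: "(\<lambda>n. G c n / p n) \<longlonglongrightarrow> q * (c * x) powr (- \<alpha>)" if "c > 0" for c
  proof -
    have cx: "c * x > 0" using that x by simp
    have "filterlim (\<lambda>n. c * x * \<gamma> n) at_top sequentially"
      by (rule filterlim_tendsto_pos_mult_at_top[OF tendsto_const cx T.\<gamma>_at_top])
    from filterlim_compose[OF q this] filterlim_compose[OF T.F_ratio[OF cx] T.\<gamma>_at_top]
    have "(\<lambda>n. G c n / abs_tail (c * x * \<gamma> n) * (abs_tail (c * x * \<gamma> n) / p n)) \<longlonglongrightarrow> q * (c * x) powr (- \<alpha>)"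
      unfolding G_def p_def by (rule tendsto_mult)
    moreover have "G c n / abs_tail (c * x * \<gamma> n) * (abs_tail (c * x * \<gamma> n) / p n) = G c n / p n" for n
      using p_pos[of "c * x * \<gamma> n"] by simp
    ultimately show ?thesis by (simp only:)
  qed
  have "P \<longlonglongrightarrow> q * x powr (- \<alpha>) * (\<mu> / (\<mu> - 1))"
  proof (rule tendsto_sandwich_family)
    fix \<epsilon> :: real assume \<epsilon>: "0 < \<epsilon>" "\<epsilon> < 1"
    have \<epsilon>x: "\<epsilon> * x > 0" using \<epsilon> x by simp
    note jumps = T.two_jumps_negligible[OF \<epsilon>x]
    let ?J = "\<lambda>n. abs_tail (\<epsilon> * x * \<gamma> n / n)"
    let ?u = "\<lambda>n. S n * (G (1 - \<epsilon>) n / p n) + (real n)\<^sup>2 * (?J n)\<^sup>2 / p n"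
    have "?u \<longlonglongrightarrow> \<mu> / (\<mu> - 1) * (q * ((1 - \<epsilon>) * x) powr (- \<alpha>)) + 0"
      unfolding p_def using \<epsilon> by (intro tendsto_add tendsto_mult S G[unfolded p_def] jumps) auto
    moreover have "eventually (\<lambda>n. P n \<le> ?u n) sequentially"
      using eventually_ge_at_top[of 1]
    proof eventually_elim
      case (elim n)
      have y: "\<gamma> n * x > 0" using \<gamma>[OF elim] x by simp
      have "prob (exceeds n (\<gamma> n * x)) \<le> (\<Sum>k=1..n. \<mu> ^ k) * G (1 - \<epsilon>) n
          + (real n)\<^sup>2 * \<mu> ^ n * (measure \<xi> {\<epsilon> * x * \<gamma> n / n <..})\<^sup>2"
        using prob_exceeds_le[OF y \<epsilon>(1) elim] by (simp add: G_def mult_ac)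
      also have "\<dots> \<le> (\<Sum>k=1..n. \<mu> ^ k) * G (1 - \<epsilon>) n + (real n)\<^sup>2 * \<mu> ^ n * (?J n)\<^sup>2"
        using \<mu> by (intro add_left_mono mult_left_mono power_mono right_tail_le) auto
      finally have "P n \<le> 1 / (\<mu> ^ n * p n) * ((\<Sum>k=1..n. \<mu> ^ k) * G (1 - \<epsilon>) n + (real n)\<^sup>2 * \<mu> ^ n * (?J n)\<^sup>2)"
        unfolding P_def using \<mu> p[of n] by (intro mult_left_mono) auto
      also have "\<dots> = ?u n"
        unfolding S_def using \<mu> p[of n] by (simp add: field_simps)
      finally show ?case .
    qed
    ultimately show "\<exists>f. f \<longlonglongrightarrow> \<mu> / (\<mu> - 1) * (q * ((1 - \<epsilon>) * x) powr (- \<alpha>)) + 0 \<and> eventually (\<lambda>n. P n \<le> f n) sequentially"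
      by blast
    obtain B where B: "B \<ge> 1" and first: "\<And>k b. (\<forall>j<k. B * sqrt \<mu> ^ j \<le> real b) \<Longrightarrow>
        (1 - \<epsilon>) * \<mu> ^ k \<le> (\<Sum>v\<in>labels b k. prob (in_tree (truncation B) v))"
      using prob_truncated_tree_ge[OF \<mu> \<epsilon>(1) ZlogZ] by blast
    obtain C where second: "\<And>b k l. pair_sum b (truncation B) k l \<le> C * \<mu> ^ (k + l)"
      using pair_sum_truncation_le[OF \<mu> B] by blast
    have C: "C \<ge> 0"
      using order_trans[OF pair_sum_nonneg second[of 0 0 0]] by simp
    let ?l = "\<lambda>n. (1 - \<epsilon>) * S n * (G (1 + \<epsilon>) n / p n) * (1 - real n * ?J n)
      - C * (S n)\<^sup>2 * (G (1 + \<epsilon>) n / p n)\<^sup>2 * (\<mu> ^ n * p n)"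
    have "?l \<longlonglongrightarrow> (1 - \<epsilon>) * (\<mu> / (\<mu> - 1)) * (q * ((1 + \<epsilon>) * x) powr (- \<alpha>)) * (1 - 0)
      - C * (\<mu> / (\<mu> - 1))\<^sup>2 * (q * ((1 + \<epsilon>) * x) powr (- \<alpha>))\<^sup>2 * 0"
      using \<epsilon> by (intro tendsto_intros S G jumps T.tail_at_\<gamma>_small[folded p_def]) auto
    then have "?l \<longlonglongrightarrow> (1 - \<epsilon>) * (\<mu> / (\<mu> - 1)) * (q * ((1 + \<epsilon>) * x) powr (- \<alpha>))" by simp
    moreover have "eventually (\<lambda>n. ?l n \<le> P n) sequentially"
      using eventually_ge_at_top[of 1]
    proof eventually_elim
      case (elim n)
      let ?h = "measure \<xi> {- (\<epsilon> * x * \<gamma> n / n)..}"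
      have y: "\<gamma> n * x > 0" using \<gamma>[OF elim] x by simp
      \<comment> \<open>No particle of the pruned tree in the first \<open>n\<close> generations keeps more than this number of children.\<close>
      define b where "b = nat \<lceil>B * sqrt \<mu> ^ n\<rceil>"
      have "B * sqrt \<mu> ^ j \<le> real b" if "j \<le> n" for j
      proof -
        have "B * sqrt \<mu> ^ j \<le> B * sqrt \<mu> ^ n"
          using B \<mu> that by (intro mult_left_mono power_increasing) auto
        then show ?thesis unfolding b_def by linarith
      qed
      then have first': "(1 - \<epsilon>) * \<mu> ^ k \<le> (\<Sum>v\<in>labels b k. prob (in_tree (truncation B) v))"
        if "k \<le> n" for k using that by (intro first) auto
      \<comment> \<open>The small jumps on one line of length \<open>n\<close> cost nothing in the limit, by the Bernoulli inequality.\<close>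
      have "1 - real n * ?J n \<le> 1 - real (n - 1) * ?J n"
        by (auto intro!: mult_right_mono)
      also have "\<dots> \<le> (1 - ?J n) ^ (n - 1)"
        using Bernoulli_inequality[of "- ?J n" "n - 1"] by simp
      also have "\<dots> \<le> ?h ^ (n - 1)"
        by (intro power_mono left_tail_ge) simp
      finally have h: "1 - real n * ?J n \<le> ?h ^ (n - 1)" .
      have "(1 - \<epsilon>) * (\<Sum>k=1..n. \<mu> ^ k) * G (1 + \<epsilon>) n * (1 - real n * ?J n)
          - C * (\<Sum>k=1..n. \<mu> ^ k)\<^sup>2 * (G (1 + \<epsilon>) n)\<^sup>2
        \<le> (1 - \<epsilon>) * (\<Sum>k=1..n. \<mu> ^ k) * G (1 + \<epsilon>) n * ?h ^ (n - 1)
          - C * (\<Sum>k=1..n. \<mu> ^ k)\<^sup>2 * (G (1 + \<epsilon>) n)\<^sup>2"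
        using \<epsilon> \<mu> by (intro diff_right_mono mult_left_mono h mult_nonneg_nonneg sum_nonneg) (auto simp: G_def)
      also have "\<dots> \<le> prob (exceeds n (\<gamma> n * x))"
        using prob_exceeds_ge[OF y \<epsilon>(1) elim pos first' second] by (simp add: G_def mult_ac)
      finally have "1 / (\<mu> ^ n * p n) * ((1 - \<epsilon>) * (\<Sum>k=1..n. \<mu> ^ k) * G (1 + \<epsilon>) n * (1 - real n * ?J n)
          - C * (\<Sum>k=1..n. \<mu> ^ k)\<^sup>2 * (G (1 + \<epsilon>) n)\<^sup>2) \<le> P n"
        unfolding P_def using \<mu> p[of n] by (intro mult_left_mono) auto
      moreover have "1 / (\<mu> ^ n * p n) * ((1 - \<epsilon>) * (\<Sum>k=1..n. \<mu> ^ k) * G (1 + \<epsilon>) n * (1 - real n * ?J n)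
          - C * (\<Sum>k=1..n. \<mu> ^ k)\<^sup>2 * (G (1 + \<epsilon>) n)\<^sup>2) = ?l n"
        unfolding S_def using \<mu> p[of n] by (simp add: divide_simps power2_eq_square)
      ultimately show ?case by simp
    qed
    ultimately show "\<exists>f. f \<longlonglongrightarrow> (1 - \<epsilon>) * (\<mu> / (\<mu> - 1)) * (q * ((1 + \<epsilon>) * x) powr (- \<alpha>)) \<and> eventually (\<lambda>n. f n \<le> P n) sequentially"
      by blast
  next
    show "((\<lambda>\<epsilon>. (1 - \<epsilon>) * (\<mu> / (\<mu> - 1)) * (q * ((1 + \<epsilon>) * x) powr (- \<alpha>))) \<longlongrightarrow> q * x powr (- \<alpha>) * (\<mu> / (\<mu> - 1))) (at_right 0)"
      using x \<mu> by (auto intro!: tendsto_eq_intros)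
    show "((\<lambda>\<epsilon>. \<mu> / (\<mu> - 1) * (q * ((1 - \<epsilon>) * x) powr (- \<alpha>)) + 0) \<longlongrightarrow> q * x powr (- \<alpha>) * (\<mu> / (\<mu> - 1))) (at_right 0)"
      using x \<mu> by (auto intro!: tendsto_eq_intros)
  qed
  then show ?thesis by (simp add: P_def[abs_def] p_def)
qed

end

section \<open>The model\<close>

lemma prob_reproduction:
  fixes Z :: "'b \<Rightarrow> nat" and X :: "nat \<Rightarrow> 'b \<Rightarrow> real"
  assumes "prob_space Q"
    and ind: "prob_space.indep_vars Q (\<lambda>_. borel) X UNIV"
    and same: "\<And>i. distr Q borel (X i) = distr Q borel (X 0)"
    and ZX: "indep_rvs Q (count_space UNIV) Z (PiM UNIV (\<lambda>_. borel)) (\<lambda>\<omega> i. X i \<omega>)"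
    and K: "finite K" and B: "\<And>i. B i \<in> sets borel"
  shows "measure (distr Q reproduction_space (reproduction Z X)) (A \<times> {x. \<forall>i\<in>K. x i \<in> B i})
      = measure (distr Q (count_space UNIV) Z) A * (\<Prod>i\<in>K. measure (distr Q borel (X 0)) (B i))"
    and "A \<times> {x. \<forall>i\<in>K. x i \<in> B i} \<in> sets reproduction_space"
proof -
  interpret Q: prob_space Q by fact
  let ?S = "PiM UNIV (\<lambda>_. borel) :: (nat \<Rightarrow> real) measure"
  let ?C = "{x :: nat \<Rightarrow> real. \<forall>i\<in>K. x i \<in> B i}"
  have Z: "Z \<in> measurable Q (count_space UNIV)" and X: "(\<lambda>\<omega> i. X i \<omega>) \<in> measurable Q ?S"
    and indep: "Q.indep_set {Z -` A \<inter> space Q | A. A \<in> sets (count_space UNIV)}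
      {(\<lambda>\<omega> i. X i \<omega>) -` B \<inter> space Q | B. B \<in> sets ?S}"
    using ZX by (auto simp: indep_rvs_def)
  have Xi: "X i \<in> borel_measurable Q" for i
    using ind by (auto simp: Q.indep_vars_def)
  have C: "?C \<in> sets ?S"
  proof -
    have "{x \<in> space ?S. x i \<in> B i} \<in> sets ?S" for i
      using measurable_sets[OF measurable_component_singleton[of i UNIV "\<lambda>_. borel"] B[of i]]
      by (simp add: vimage_def Int_def conj_commute)
    then have "{x \<in> space ?S. \<forall>i\<in>K. x i \<in> B i} \<in> sets ?S"
      by (intro sets.sets_Collect_finite_All K)
    then show ?thesis by (simp add: space_PiM)
  qed
  show box: "A \<times> ?C \<in> sets reproduction_space"
    unfolding reproduction_space_def by (intro pair_measureI C) auto
  have rep: "reproduction Z X \<in> measurable Q reproduction_space"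
    unfolding reproduction_def[abs_def] reproduction_space_def by (intro measurable_Pair Z X)
  have "measure (distr Q reproduction_space (reproduction Z X)) (A \<times> ?C)
      = measure Q ((Z -` A \<inter> space Q) \<inter> ((\<lambda>\<omega> i. X i \<omega>) -` ?C \<inter> space Q))"
    using rep box by (subst measure_distr) (auto simp: reproduction_def intro!: arg_cong[of _ _ "measure Q"])
  also have "\<dots> = measure Q (Z -` A \<inter> space Q) * measure Q ((\<lambda>\<omega> i. X i \<omega>) -` ?C \<inter> space Q)"
    using C by (intro Q.indep_setD[OF indep] CollectI exI conjI refl) auto
  also have "measure Q (Z -` A \<inter> space Q) = measure (distr Q (count_space UNIV) Z) A"
    using Z by (subst measure_distr) auto
  also have "measure Q ((\<lambda>\<omega> i. X i \<omega>) -` ?C \<inter> space Q) = (\<Prod>i\<in>K. measure (distr Q borel (X 0)) (B i))"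
  proof (cases "K = {}")
    case False
    have "(\<lambda>\<omega> i. X i \<omega>) -` ?C \<inter> space Q = (\<Inter>i\<in>K. X i -` B i \<inter> space Q)"
      using False by auto
    also have "measure Q \<dots> = (\<Prod>i\<in>K. measure Q (X i -` B i \<inter> space Q))"
      using False K B by (intro Q.indep_varsD[OF ind]) auto
    also have "\<dots> = (\<Prod>i\<in>K. measure (distr Q borel (X i)) (B i))"
      using Xi B by (intro prod.cong refl measure_distr[symmetric]) auto
    also have "\<dots> = (\<Prod>i\<in>K. measure (distr Q borel (X 0)) (B i))"
      by (intro prod.cong refl) (subst same, rule refl)
    finally show ?thesis .
  qed (simp add: Q.prob_space)
  finally show "measure (distr Q reproduction_space (reproduction Z X)) (A \<times> ?C)
      = measure (distr Q (count_space UNIV) Z) A * (\<Prod>i\<in>K. measure (distr Q borel (X 0)) (B i))" .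
qed

text \<open>
  The reproductions of different particles are independent, and within one particle the number of
  children and the displacements are independent. So a finite set of constraints is grouped by
  particles, and its probability factorizes twice.
\<close>

lemma branching_data_branching_random_walk:
  fixes Z :: "'b \<Rightarrow> nat" and X :: "nat \<Rightarrow> 'b \<Rightarrow> real"
  assumes "prob_space Q"
    and ind: "prob_space.indep_vars Q (\<lambda>_. borel) X UNIV"
    and same: "\<And>i. distr Q borel (X i) = distr Q borel (X 0)"
    and ZX: "indep_rvs Q (count_space UNIV) Z (PiM UNIV (\<lambda>_. borel)) (\<lambda>\<omega> i. X i \<omega>)"
    and int: "integrable Q (\<lambda>\<omega>. real (Z \<omega>))"
    and BRW: "branching_random_walk Q Z X M N D"
  shows "branching_data M N D (distr Q (count_space UNIV) Z) (distr Q borel (X 0))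
    (prob_space.expectation Q (\<lambda>\<omega>. real (Z \<omega>)))"
proof -
  interpret Q: prob_space Q by fact
  interpret M: prob_space M using BRW by (simp add: branching_random_walk_def)
  let ?\<zeta> = "distr Q (count_space UNIV) Z" and ?\<xi> = "distr Q borel (X 0)"
  have Z: "Z \<in> measurable Q (count_space UNIV)" using ZX by (auto simp: indep_rvs_def)
  have X0: "X 0 \<in> borel_measurable Q" using ind by (auto simp: Q.indep_vars_def)
  have indM: "M.indep_vars (\<lambda>_. reproduction_space) (\<lambda>v. reproduction (N v) (D v)) UNIV"
    and law: "\<And>v. distr M reproduction_space (reproduction (N v) (D v))
      = distr Q reproduction_space (reproduction Z X)"
    using BRW by (auto simp: branching_random_walk_def)
  have rep: "reproduction (N v) (D v) \<in> measurable M reproduction_space" for v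
    using indM by (auto simp: M.indep_vars_def)
  show ?thesis
  proof (intro branching_data.intro branching_data_axioms.intro)
    show "prob_space M" by (rule M.prob_space_axioms)
    show "prob_space ?\<zeta>" "prob_space ?\<xi>" using Z X0 by (auto intro: Q.prob_space_distr)
    show "sets ?\<zeta> = UNIV" "sets ?\<xi> = sets borel" by simp_all
    show "N v \<in> measurable M (count_space UNIV)" for v
      using measurable_comp[OF rep[of v, unfolded reproduction_space_def] measurable_fst]
      by (simp add: reproduction_def comp_def)
    show "D v i \<in> borel_measurable M" for v i
      using measurable_comp[OF measurable_comp[OF rep[of v, unfolded reproduction_space_def] measurable_snd]
          measurable_component_singleton[of i UNIV "\<lambda>_. borel"]]
      by (simp add: reproduction_def comp_def)
    show "integrable ?\<zeta> real" using Z int by (subst integrable_distr_eq) auto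
    show "Q.expectation (\<lambda>\<omega>. real (Z \<omega>)) = integral\<^sup>L ?\<zeta> real" using Z by (subst integral_distr) auto
    fix J :: "nat list set" and K :: "(nat list \<times> nat) set"
      and A :: "nat list \<Rightarrow> nat set" and B :: "nat list \<times> nat \<Rightarrow> real set"
    assume J: "finite J" and K: "finite K" and B: "\<And>e. B e \<in> sets borel"
    \<comment> \<open>The particles constrained by \<open>J\<close> or \<open>K\<close>, and the constraint \<open>R v\<close> on the reproduction of \<open>v\<close>.\<close>
    define I where "I = J \<union> fst ` K"
    define A' where "A' v = (if v \<in> J then A v else UNIV)" for v
    define K' where "K' v = {i. (v, i) \<in> K}" for v
    define R where "R v = A' v \<times> {x. \<forall>i\<in>K' v. x i \<in> B (v, i)}" for v
    have I: "finite I" using J K by (simp add: I_def)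
    have K': "finite (K' v)" for v
      unfolding K'_def by (rule finite_subset[of _ "snd ` K"]) (use K in force)+
    have R_sets: "R v \<in> sets reproduction_space" for v
      unfolding R_def by (rule prob_reproduction(2)[OF assms(1-4) K' B])
    have R_prob: "M.prob (reproduction (N v) (D v) -` R v \<inter> space M)
        = measure ?\<zeta> (A' v) * (\<Prod>i\<in>K' v. measure ?\<xi> (B (v, i)))" for v
    proof -
      have "M.prob (reproduction (N v) (D v) -` R v \<inter> space M)
          = measure (distr M reproduction_space (reproduction (N v) (D v))) (R v)"
        using rep R_sets by (subst measure_distr) auto
      then show ?thesis
        unfolding law R_def by (simp add: prob_reproduction(1)[OF assms(1-4) K' B])
    qed
    let ?E = "{\<omega> \<in> space M. (\<forall>v\<in>J. N v \<omega> \<in> A v) \<and> (\<forall>e\<in>K. D (fst e) (snd e) \<omega> \<in> B e)}"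
    have "M.prob ?E = (\<Prod>v\<in>I. M.prob (reproduction (N v) (D v) -` R v \<inter> space M))"
    proof (cases "I = {}")
      case True
      then have "J = {}" "K = {}" by (auto simp: I_def)
      then show ?thesis using True by (simp add: M.prob_space)
    next
      case False
      have "?E = (\<Inter>v\<in>I. reproduction (N v) (D v) -` R v \<inter> space M)"
      proof (intro set_eqI iffI)
        fix \<omega> assume "\<omega> \<in> ?E"
        then show "\<omega> \<in> (\<Inter>v\<in>I. reproduction (N v) (D v) -` R v \<inter> space M)"
          by (fastforce simp: R_def A'_def K'_def reproduction_def)
      next
        fix \<omega> assume \<omega>: "\<omega> \<in> (\<Inter>v\<in>I. reproduction (N v) (D v) -` R v \<inter> space M)"
        then have "reproduction (N v) (D v) \<omega> \<in> R v" if "v \<in> I" for v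
          using that by blast
        then have "N v \<omega> \<in> A' v" "\<forall>i\<in>K' v. D v i \<omega> \<in> B (v, i)" if "v \<in> I" for v
          using that by (auto simp: R_def reproduction_def)
        moreover have "\<omega> \<in> space M" using \<omega> False by auto
        ultimately show "\<omega> \<in> ?E"
          by (fastforce simp: I_def A'_def K'_def split: if_splits)
      qed
      then show ?thesis
        using False I R_sets by (simp only:) (intro M.indep_varsD[OF indM], auto)
    qed
    also have "\<dots> = (\<Prod>v\<in>I. measure ?\<zeta> (A' v)) * (\<Prod>v\<in>I. \<Prod>i\<in>K' v. measure ?\<xi> (B (v, i)))"
      by (simp only: R_prob prod.distrib)
    also have "(\<Prod>v\<in>I. measure ?\<zeta> (A' v)) = (\<Prod>v\<in>J. measure ?\<zeta> (A v))"
    proof (rule prod.mono_neutral_cong_right[OF I])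
      show "J \<subseteq> I" by (auto simp: I_def)
      interpret \<zeta>: prob_space ?\<zeta> using Z by (rule Q.prob_space_distr)
      show "\<forall>v\<in>I - J. measure ?\<zeta> (A' v) = 1"
        using \<zeta>.prob_space by (auto simp: A'_def)
    qed (auto simp: A'_def)
    also have "(\<Prod>v\<in>I. \<Prod>i\<in>K' v. measure ?\<xi> (B (v, i))) = (\<Prod>e\<in>Sigma I K'. measure ?\<xi> (B e))"
      using I K' by (subst prod.Sigma) (auto simp: split_def)
    also have "Sigma I K' = K" by (force simp: I_def K'_def)
    finally show "M.prob ?E = (\<Prod>v\<in>J. measure ?\<zeta> (A v)) * (\<Prod>e\<in>K. measure ?\<xi> (B e))" .
  qed
qed

lemma regularly_varying_tail_of_law:
  fixes \<xi> :: "real measure"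
  assumes "prob_space \<xi>" "sets \<xi> = sets borel" and \<alpha>: "\<alpha> > 0" and L: "slowly_varying L"
    and F: "\<And>t. t > 0 \<Longrightarrow> measure \<xi> {x. \<bar>x\<bar> > t} = t powr (- \<alpha>) * L t"
  shows "regularly_varying_tail (\<lambda>t. measure \<xi> {x. \<bar>x\<bar> > t}) \<alpha>"
proof
  interpret prob_space \<xi> by fact
  have [simp]: "{x. \<bar>x\<bar> > t} \<in> sets \<xi>" for t unfolding assms(2) by measurable
  show "measure \<xi> {x. \<bar>x\<bar> > t} \<le> measure \<xi> {x. \<bar>x\<bar> > s}" if "s \<le> t" for s t
    using that by (intro finite_measure_mono) auto
  show "((\<lambda>t. measure \<xi> {x. \<bar>x\<bar> > c * t} / measure \<xi> {x. \<bar>x\<bar> > t}) \<longlongrightarrow> c powr (- \<alpha>)) at_top"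
    if c: "c > 0" for c
  proof -
    have "((\<lambda>t. c powr (- \<alpha>) * (L (t * c) / L t)) \<longlongrightarrow> c powr (- \<alpha>) * 1) at_top"
      using L c by (intro tendsto_intros) (auto simp: slowly_varying_def)
    moreover have "eventually (\<lambda>t. c powr (- \<alpha>) * (L (t * c) / L t)
        = measure \<xi> {x. \<bar>x\<bar> > c * t} / measure \<xi> {x. \<bar>x\<bar> > t}) at_top"
      using eventually_gt_at_top[of 0]
    proof eventually_elim
      case (elim t)
      then show ?case using c by (simp add: F powr_mult mult_ac)
    qed
    ultimately show ?thesis by (simp add: tendsto_cong)
  qed
qed (use assms prob_space.prob_le_1 in auto)

theorem theorem1p3:
  fixes Q :: "'b measure" and Z :: "'b \<Rightarrow> nat" and X :: "nat \<Rightarrow> 'b \<Rightarrow> real"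
    and M :: "'a measure" and N :: "nat list \<Rightarrow> 'a \<Rightarrow> nat" and D :: "nat list \<Rightarrow> nat \<Rightarrow> 'a \<Rightarrow> real"
    and L :: "real \<Rightarrow> real" and \<alpha> q \<mu> :: real and \<gamma> b r :: "nat \<Rightarrow> real"
  assumes "prob_space Q"
    and "prob_space.indep_vars Q (\<lambda>_. borel) X UNIV"
    and "\<And>i. distr Q borel (X i) = distr Q borel (X 0)"
    and "indep_rvs Q (count_space UNIV) Z (PiM UNIV (\<lambda>_. borel)) (\<lambda>\<omega> i. X i \<omega>)"
    and "\<alpha> > 0" and "slowly_varying L"
    and "\<And>x. x > 0 \<Longrightarrow> \<P>(\<omega> in Q. \<bar>X 0 \<omega>\<bar> > x) = x powr (- \<alpha>) * L x"
    and "q \<in> {0..1}"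
    and "((\<lambda>x. \<P>(\<omega> in Q. X 0 \<omega> > x) / \<P>(\<omega> in Q. \<bar>X 0 \<omega>\<bar> > x)) \<longlongrightarrow> q) at_top"
    and "\<P>(\<omega> in Q. Z \<omega> \<ge> 1) = 1"
    and "integrable Q (\<lambda>\<omega>. real (Z \<omega>))"
    and "\<mu> = prob_space.expectation Q (\<lambda>\<omega>. real (Z \<omega>))"
    and "\<mu> > 1"
    and "integrable Q (\<lambda>\<omega>. real (Z \<omega>) * log_plus (real (Z \<omega>)))"
    and "branching_random_walk Q Z X M N D"
    and "\<And>n. n \<ge> 1 \<Longrightarrow> b n = Inf {x. \<P>(\<omega> in Q. \<bar>X 0 \<omega>\<bar> > x) \<le> 1 / \<mu> ^ n}"
    and "\<And>n. n \<ge> 1 \<Longrightarrow> \<gamma> n > 0"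
    and "(\<lambda>n. b n / \<gamma> n) \<longlonglongrightarrow> 0"
    and "\<And>n. n \<ge> 1 \<Longrightarrow> r n = 1 / (\<mu> ^ n * \<P>(\<omega> in Q. \<bar>X 0 \<omega>\<bar> > \<gamma> n))"
    and "x > 0"
  shows "(\<lambda>n. r n * \<P>(\<omega> in M. max_position N D n \<omega> > \<gamma> n * x))
           \<longlonglongrightarrow> q * x powr (- \<alpha>) * (\<mu> / (\<mu> - 1))"
proof -
  interpret Q: prob_space Q by fact
  let ?\<zeta> = "distr Q (count_space UNIV) Z" and ?\<xi> = "distr Q borel (X 0)"
  have Z: "Z \<in> measurable Q (count_space UNIV)" using assms(4) by (simp add: indep_rvs_def)
  have X0: "X 0 \<in> borel_measurable Q" using assms(2) by (auto simp: Q.indep_vars_def)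
  interpret branching_data M N D ?\<zeta> ?\<xi> \<mu>
    unfolding assms(12)
    by (rule branching_data_branching_random_walk[OF assms(1-4) assms(11) assms(15)])
  have abs: "measure ?\<xi> {x. \<bar>x\<bar> > t} = \<P>(\<omega> in Q. \<bar>X 0 \<omega>\<bar> > t)" for t
    using X0 by (subst measure_distr) (auto intro!: arg_cong[of _ _ "measure Q"])
  have right: "measure ?\<xi> {t<..} = \<P>(\<omega> in Q. X 0 \<omega> > t)" for t
    using X0 by (subst measure_distr) (auto intro!: arg_cong[of _ _ "measure Q"])
  have pos: "measure ?\<zeta> {1..} = 1"
  proof -
    have "measure ?\<zeta> {1..} = \<P>(\<omega> in Q. Z \<omega> \<ge> 1)"
      using Z by (subst measure_distr) (auto intro!: arg_cong[of _ _ "measure Q"])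
    then show ?thesis using assms(10) by simp
  qed
  have "(\<lambda>n. 1 / (\<mu> ^ n * measure ?\<xi> {x. \<bar>x\<bar> > \<gamma> n}) * prob (exceeds n (\<gamma> n * x)))
      \<longlonglongrightarrow> q * x powr (- \<alpha>) * (\<mu> / (\<mu> - 1))"
  proof (rule max_position_tail[OF assms(13) pos _ _ _ _ assms(17) assms(18) assms(20)])
    show "integrable ?\<zeta> (\<lambda>m. real m * log_plus (real m))"
      using Z assms(14) by (subst integrable_distr_eq) auto
    show "regularly_varying_tail (\<lambda>t. measure ?\<xi> {x. \<bar>x\<bar> > t}) \<alpha>"
      using assms(5-7) by (intro regularly_varying_tail_of_law[where L = L]) (auto simp: abs \<xi>.prob_space_axioms)
    show "((\<lambda>t. measure ?\<xi> {t<..} / measure ?\<xi> {x. \<bar>x\<bar> > t}) \<longlongrightarrow> q) at_top"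
      unfolding abs right by (rule assms(9))
    show "b n = Inf {x. measure ?\<xi> {x'. \<bar>x'\<bar> > x} \<le> 1 / \<mu> ^ n}" if "n \<ge> 1" for n
      unfolding abs by (rule assms(16)[OF that])
  qed
  moreover have "eventually (\<lambda>n. 1 / (\<mu> ^ n * measure ?\<xi> {x. \<bar>x\<bar> > \<gamma> n}) * prob (exceeds n (\<gamma> n * x))
      = r n * \<P>(\<omega> in M. max_position N D n \<omega> > \<gamma> n * x)) sequentially"
    using eventually_ge_at_top[of 1]
    by eventually_elim (simp add: assms(19) abs prob_max_position[OF pos])
  ultimately show ?thesis by (rule Lim_transform_eventually)
qed

end
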